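(* Let $p\ge1$ be an integer and let $e_1,\dots,e_p,d_1,\dots,d_p$ be real numbers with $$0<e_1\le e_2\le\dots\le e_p,\qquad -p<d_1\le d_2\le\dots\le d_p,\qquad d_1\cdots d_p=0,$$ and, with $E=e_1+\dots+e_p$ and $D=d_1+\dots+d_p$, $$1<\frac{E-D}{p}<p-1$$ (hence $p\ge3$). Then the type $\tau$ of the indeterminate Stieltjes moment problem with birth and death rates $$\lambda_n=(pn+e_1)\cdots(pn+e_p),\qquad \mu_n=(pn+d_1)\cdots(pn+d_p),\qquad n\ge0,$$ satisfies $$\frac{\pi}{p\sin(\pi/p)}\le\tau\le\frac{\pi}{p\sin(\pi/p)\cos(\pi/p)}.$$
   Context: The Stieltjes moment problem with birth rates $\lambda_n$ and death rates $\mu_n$ ($\lambda_n,\mu_{n+1}>0$ for $n\ge 0$, $\mu_0=0$) is the moment problem with Jacobi parameters $a_n=\lambda_n+\mu_n$, $b_n=\sqrt{\lambda_n\mu_{n+1}}$, $n\ge0$. The condition $1<(E-D)/p<p-1$ is known to be equivalent to its indeterminacy. For Jacobi parameters $(a_n)$ (real), $(b_n)$ (positive), the orthonormal polynomials $P_n$ and the polynomials of the second kind $Q_n$ both satisfy $z r_n(z)=b_nr_{n+1}(z)+a_nr_n(z)+b_{n-1}r_{n-1}(z)$ for $n\ge0$, with $b_{-1}:=1$, $P_{-1}=0$, $P_0=1$, $Q_{-1}=-1$, $Q_0=0$. In the indeterminate case $\sum_{n}(P_n^2(0)+Q_n^2(0))<\infty$ and the following are entire functions: $$A(z)=z\sum_{k\ge0}Q_k(0)Q_k(z),\quad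 B(z)=-1+z\sum_{k\ge0}Q_k(0)P_k(z),$$ $$C(z)=1+z\sum_{k\ge0}P_k(0)Q_k(z),\quad D(z)=z\sum_{k\ge0}P_k(0)P_k(z).$$ (The function $D(z)$ is unrelated to the number $D$.) These four functions are known to have a common order $\rho\in[0,1]$ and, if $\rho>0$, a common type; these are called the order and type of the moment problem. For the moment problems considered here the order is $1/p$ (a theorem of Romanov). For a non-constant entire function $f(z)=\sum c_nz^n$ with $\mathcal M_f(r)=\max_{|z|=r}|f(z)|$, the order is $\rho_f=\limsup_{r\to\infty}\frac{\log\log\mathcal M_f(r)}{\log r}$, and if $0<\rho_f<\infty$ the type is $\tau_f=\limsup_{r\to\infty}\frac{\log\mathcal M_f(r)}{r^{\rho_f}}$. *)

theory Defs
  imports "HOL-Analysis.Analysis"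
begin

text \<open>
  The index is shifted by one: \<open>three_term a b u v z (Suc n)\<close> is $r_n(z)$ for the solution of
  $z r_n = b_n r_{n+1} + a_n r_n + b_{n-1} r_{n-1}$ with $r_{-1} = u$, $r_0 = v$ and the
  convention $b_{-1} = 1$.
\<close>

fun three_term ::
  "(nat \<Rightarrow> real) \<Rightarrow> (nat \<Rightarrow> real) \<Rightarrow> complex \<Rightarrow> complex \<Rightarrow> complex \<Rightarrow> nat \<Rightarrow> complex" where
  "three_term a b u v z 0 = u"
| "three_term a b u v z (Suc 0) = v"
| "three_term a b u v z (Suc (Suc n)) =
     ((z - of_real (a n)) * three_term a b u v z (Suc n)
        - of_real (if n = 0 then 1 else b (n - 1)) * three_term a b u v z n) / of_real (b n)"

definition orthP :: "(nat \<Rightarrow> real) \<Rightarrow> (nat \<Rightarrow> real) \<Rightarrow> nat \<Rightarrow> complex \<Rightarrow> complex" where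
  "orthP a b n z = three_term a b 0 1 z (Suc n)"

definition orthQ :: "(nat \<Rightarrow> real) \<Rightarrow> (nat \<Rightarrow> real) \<Rightarrow> nat \<Rightarrow> complex \<Rightarrow> complex" where
  "orthQ a b n z = three_term a b (- 1) 0 z (Suc n)"

definition nevA :: "(nat \<Rightarrow> real) \<Rightarrow> (nat \<Rightarrow> real) \<Rightarrow> complex \<Rightarrow> complex" where
  "nevA a b z = z * (\<Sum>k. orthQ a b k 0 * orthQ a b k z)"

definition nevB :: "(nat \<Rightarrow> real) \<Rightarrow> (nat \<Rightarrow> real) \<Rightarrow> complex \<Rightarrow> complex" where
  "nevB a b z = - 1 + z * (\<Sum>k. orthQ a b k 0 * orthP a b k z)"

definition nevC :: "(nat \<Rightarrow> real) \<Rightarrow> (nat \<Rightarrow> real) \<Rightarrow> complex \<Rightarrow> complex" where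
  "nevC a b z = 1 + z * (\<Sum>k. orthP a b k 0 * orthQ a b k z)"

definition nevD :: "(nat \<Rightarrow> real) \<Rightarrow> (nat \<Rightarrow> real) \<Rightarrow> complex \<Rightarrow> complex" where
  "nevD a b z = z * (\<Sum>k. orthP a b k 0 * orthP a b k z)"

text \<open>For continuous \<open>f\<close> and $r \ge 0$ the supremum is attained, so it is the maximum.\<close>

definition max_modulus :: "(complex \<Rightarrow> complex) \<Rightarrow> real \<Rightarrow> real" where
  "max_modulus f r = (SUP z\<in>sphere 0 r. norm (f z))"

definition growth_order :: "(complex \<Rightarrow> complex) \<Rightarrow> ereal" where
  "growth_order f = Limsup at_top (\<lambda>r. ereal (ln (ln (max_modulus f r)) / ln r))"

text \<open>Meaningful only if the order is positive and finite.\<close>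

definition growth_type :: "(complex \<Rightarrow> complex) \<Rightarrow> ereal" where
  "growth_type f =
     Limsup at_top (\<lambda>r. ereal (ln (max_modulus f r) / r powr real_of_ereal (growth_order f)))"

text \<open>
  The moment problem with Jacobi parameters \<open>a\<close>, \<open>b\<close> has (finite) type \<open>\<tau>\<close>: the four entire
  functions have a common order, positive and finite, and the common type \<open>\<tau>\<close>. Summability of
  $P_n(0)^2 + Q_n(0)^2$, which holds exactly for indeterminate problems, guarantees that the
  defining series converge, so that none of the values above is a default value.
  The polynomials have real coefficients, so the norms at \<open>0\<close> are absolute values of reals.
\<close>

definition moment_problem_has_type ::
  "(nat \<Rightarrow> real) \<Rightarrow> (nat \<Rightarrow> real) \<Rightarrow> real \<Rightarrow> bool" where
  "moment_problem_has_type a b \<tau> \<longleftrightarrow>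
     summable (\<lambda>n. (norm (orthP a b n 0))\<^sup>2 + (norm (orthQ a b n 0))\<^sup>2) \<and>
     (\<exists>\<rho>. 0 < \<rho> \<and> \<rho> < \<infinity> \<and>
        (\<forall>f \<in> {nevA a b, nevB a b, nevC a b, nevD a b}.
           growth_order f = \<rho> \<and> growth_type f = ereal \<tau>))"

definition birth_death_a :: "(nat \<Rightarrow> real) \<Rightarrow> (nat \<Rightarrow> real) \<Rightarrow> nat \<Rightarrow> real" where
  "birth_death_a lam mu n = lam n + mu n"

definition birth_death_b :: "(nat \<Rightarrow> real) \<Rightarrow> (nat \<Rightarrow> real) \<Rightarrow> nat \<Rightarrow> real" where
  "birth_death_b lam mu n = sqrt (lam n * mu (Suc n))"

end

theory Submission
  imports Defs "HOL-Real_Asymp.Real_Asymp"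
begin

text \<open>
  \<^bold>\<open>The problem as a string.\<close> Put $m_n = \lambda_0 \cdots \lambda_{n-1} / (\mu_1 \cdots \mu_n)$ and
  $l_n = 1 / (\lambda_n m_n)$. Up to the factor $(-1)^n \sqrt{m_n}$, the orthonormal polynomials at
  $z$ are the displacements $y_n$ of a string with point masses $m_n$ separated by gaps $l_n$, namely
  \[ f_{n+1} = f_n + w\, m_n y_n, \qquad y_{n+1} = y_n + l_n f_{n+1}, \qquad w = -z , \]
  started at $(y_0, f_0) = (1, 0)$ for $P_n$ and, up to sign, at $(0, 1)$ for $Q_n$. With
  $s = (E - D)/p$ the masses behave like $n^{s-p}$ and the gaps like $n^{-s}$, so $1 < s < p - 1$ says
  that the string has finite mass and finite length.

  All coefficients of this system are positive, so each of the functions $A, B, C, D$ is largest on the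
  circle $|z| = x$ at $z = -x$, up to a bounded error. There they all agree with
  $\sigma(x) = |D(-x)|$ (\<open>D_mod\<close>) up to factors that are powers of $x$
  (\<open>max_modulus_comparable\<close>), while $\ln \sigma(x)$ will be
  of the order $x^{1/p}$. Hence the four functions have the same order and the same type, and the
  type is the upper limit of $\ln \sigma(x) / x^{1/p}$.

  \<^bold>\<open>Lower bound.\<close> The recursion gives $y_{n+1} \ge (1 + x/\lambda_n)\, y_n$ because
  $m_n l_n = 1/\lambda_n$, so $\ln \sigma(x)$ is at least $\sum_n \ln (1 + x/\lambda_n)$ up to a
  bounded term (\<open>sum_ln_le_ln_D_mod\<close>).

  \<^bold>\<open>Upper bound.\<close> In the weighted norm $y_n + c_n f_n$ with $c_n^2 = l_n / (x\, m_n)$ both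
  half steps of the recursion cost the same factor $1 + \sqrt{x/\lambda_n}$. The change of the
  weight from $c_n$ to $c_{n+1}$ costs at most $(1 + 1/(n+1))^K$, and from $n \approx x^{1/\delta}$ on
  the remaining mass is so small that the plain norm $y_n + f_n$ grows by a bounded factor only. So
  $\ln \sigma(x) \le 2 \sum_n \ln (1 + \sqrt{x/\lambda_n}) + O(\ln x)$ (\<open>ln_D_mod_le\<close>).

  \<^bold>\<open>The constants.\<close> As $\lambda_n$ lies between $(pn)^p$ and $(p(n+k))^p$, both sums compare with
  Riemann sums with step $h = p\, x^{-1/p}$ of
  \[ \int_0^\infty \ln (1 + y^{-q})\, dy = \frac{\pi}{\sin (\pi/q)} \]
  with $q = p$ in the lower and $q = p/2$ in the upper bound. The integral is a Beta integral after
  an integration by parts (\<open>log_antiderivative\<close>). This gives the limits $\pi / (p \sin (\pi/p))$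
  and $2 \pi / (p \sin (2\pi/p)) = \pi / (p \sin (\pi/p) \cos (\pi/p))$.
\<close>

section \<open>The integral of $\ln (1 + y^{-q})$ and its Riemann sums\<close>

text \<open>
  The substitution $t = 1 / (1 + y^{-q})$ turns $y$ into $(t/(1-t))^{1/q}$ and $\ln (1 + y^{-q})$ into
  $-\ln t$. Integrating by parts leaves $\int t^{1/q-1} (1-t)^{-1/q}\, dt$, the integral for
  $B(1/q, 1 - 1/q) = \pi / \sin (\pi/q)$, cut off at $t(y)$. The antiderivative with its two limits,
  instead of an improper integral, is what the mean value theorem needs below.
\<close>

lemma log_antiderivative:
  fixes q :: real
  assumes q: "q > 1"
  obtains G :: "real \<Rightarrow> real" where
    "\<And>y. y > 0 \<Longrightarrow> (G has_real_derivative ln (1 + y powr (- q))) (at y)"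
    "(G \<longlongrightarrow> 0) (at_right 0)"
    "(G \<longlongrightarrow> pi / sin (pi / q)) at_top"
proof -
  define a where "a = 1 / q"
  have a: "0 < a" "a < 1" "q * a = 1" "q = 1 / a" using q by (auto simp: a_def)
  define \<beta> where "\<beta> = (\<lambda>s::real. s powr (a - 1) * (1 - s) powr (- a))"
  define I where "I = (\<lambda>t. integral {0..t} \<beta>)"
  define t where "t = (\<lambda>y::real. inverse (1 + y powr (- q)))"
  define G where "G = (\<lambda>y. y * ln (1 + y powr (- q)) + I (t y))"
  have beta: "(\<beta> has_integral Beta a (1 - a)) {0..1}"
    using has_integral_Beta_real[of a "1 - a"] a by (simp add: \<beta>_def)
  then have int: "\<beta> integrable_on {0..1}" by blast
  have I01: "I 0 = 0" "I 1 = Beta a (1 - a)"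
    using beta by (auto simp: I_def integral_unique)
  have refl: "Beta a (1 - a) = pi / sin (pi / q)"
  proof -
    have "complex_of_real (Gamma a * Gamma (1 - a)) = complex_of_real (pi / sin (pi * a))"
      using Gamma_reflection_complex[of "of_real a"]
      by (simp flip: Gamma_complex_of_real sin_of_real)
    then have "Gamma a * Gamma (1 - a) = pi / sin (pi * a)"
      by (rule of_real_eq_iff[THEN iffD1])
    then show ?thesis by (simp add: Beta_def a_def)
  qed
  have contI: "continuous_on {0..1} I"
    unfolding I_def by (rule indefinite_integral_continuous_1[OF int])
  have derI: "(I has_real_derivative \<beta> s) (at s)" if s: "0 < s" "s < 1" for s
  proof -
    have "isCont \<beta> s" unfolding \<beta>_def using s by (intro continuous_intros) auto
    then have "(I has_vector_derivative \<beta> s) (at s within {0..1})"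
      unfolding I_def using s
        integral_has_vector_derivative_continuous_at[OF int, of s "{}"]
      by (auto intro: continuous_at_imp_continuous_at_within)
    moreover have "at s within {0..1} = at s"
      using s by (intro at_within_interior) auto
    ultimately show ?thesis by (simp add: has_real_derivative_iff_has_vector_derivative)
  qed
  show thesis
  proof (rule that[of G])
    fix y :: real assume y: "y > 0"
    define v where "v = y powr (- q)"
    have v: "v > 0" using y by (simp add: v_def)
    have ty: "0 < t y" "t y < 1" using v by (auto simp: t_def v_def[symmetric] field_simps add_pos_pos)
    \<comment> \<open>This expresses $\beta(t(y)) = y / t(y)$, the relation that cancels the terms
       of the integration by parts.\<close>
    have one: "1 - t y = v * t y" using v by (simp add: t_def v_def[symmetric] field_simps)
    have va: "v powr (- a) = y" using y a by (simp add: v_def powr_powr mult.commute)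
    have "\<beta> (t y) = t y powr (a - 1) * (v powr (- a) * t y powr (- a))"
      using v ty by (simp add: \<beta>_def one powr_mult)
    also have "\<dots> = y / t y"
      using ty unfolding va by (simp add: powr_minus powr_diff field_simps)
    finally have bt: "\<beta> (t y) = y / t y" .
    have dv: "((\<lambda>y. y powr (- q)) has_real_derivative - q * y powr (- q - 1)) (at y)"
      using has_real_derivative_powr[of y "- q"] y by simp
    have v1: "y powr (- q - 1) = v / y" using y by (simp add: v_def powr_diff)
    have dt: "(t has_real_derivative q * (v / y) * (t y)\<^sup>2) (at y)"
      unfolding t_def using v y
      by (auto intro!: derivative_eq_intros dv simp: v1 v_def[symmetric] power2_eq_square)
    have dI: "((\<lambda>y. I (t y)) has_real_derivative y / t y * (q * (v / y) * (t y)\<^sup>2)) (at y)"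
      using DERIV_chain2[OF derI[OF ty] dt] by (simp add: bt)
    have dl: "((\<lambda>y. y * ln (1 + y powr (- q))) has_real_derivative
        ln (1 + v) + y * (- q * (v / y) * t y)) (at y)"
      using v y by (auto intro!: derivative_eq_intros dv simp: v1 v_def[symmetric] t_def divide_inverse)
    show "(G has_real_derivative ln (1 + y powr (- q))) (at y)"
      unfolding G_def
      by (rule DERIV_cong[OF DERIV_add[OF dl dI]])
         (use y ty in \<open>simp add: v_def power2_eq_square\<close>)
  next
    have t0: "(t \<longlongrightarrow> 0) (at_right 0)" unfolding t_def using q by real_asymp
    have "((\<lambda>y. I (t y)) \<longlongrightarrow> I 0) (at_right 0)"
      by (rule continuous_on_tendsto_compose[OF contI t0])
         (auto simp: t_def eventually_at_filter field_simps add_pos_nonneg)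
    moreover have "((\<lambda>y. y * ln (1 + y powr (- q))) \<longlongrightarrow> 0) (at_right 0)"
      using q by real_asymp
    ultimately show "(G \<longlongrightarrow> 0) (at_right 0)"
      unfolding G_def using I01 tendsto_add by fastforce
  next
    have t1: "(t \<longlongrightarrow> 1) at_top" unfolding t_def using q by real_asymp
    have "((\<lambda>y. I (t y)) \<longlongrightarrow> I 1) at_top"
      by (rule continuous_on_tendsto_compose[OF contI t1])
         (auto simp: t_def field_simps add_pos_nonneg)
    moreover have "((\<lambda>y. y * ln (1 + y powr (- q))) \<longlongrightarrow> 0) at_top"
      using q by real_asymp
    ultimately show "(G \<longlongrightarrow> pi / sin (pi / q)) at_top"
      unfolding G_def using I01 refl tendsto_add by fastforce
  qed
qed

lemma log_kernel_antimono:
  fixes q :: real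
  assumes "q > 0" "0 < x" "x \<le> y"
  shows "ln (1 + y powr (- q)) \<le> ln (1 + x powr (- q))"
  using assms powr_mono2'[of "- q" x y] by (simp add: add_pos_nonneg)

text \<open>
  The summands decrease in $n$, so every $h\,g(nh)$ with $n \ge 1$ lies below the integral of $g$ over
  the cell to its left. On the first cell $g$ is unbounded at $0$, and there a limit replaces the mean
  value theorem.
\<close>

lemma sum_log_le:
  fixes q h :: real
  assumes q: "q > 1" and h: "h > 0"
  shows "h * (\<Sum>n=1..<N. ln (1 + (real n * h) powr (- q))) \<le> pi / sin (pi / q)"
proof -
  define g where "g = (\<lambda>y::real. ln (1 + y powr (- q)))"
  obtain G where der: "\<And>y. y > 0 \<Longrightarrow> (G has_real_derivative g y) (at y)"
    and G0: "(G \<longlongrightarrow> 0) (at_right 0)"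
    and Ginf: "(G \<longlongrightarrow> pi / sin (pi / q)) at_top"
    using log_antiderivative[OF q] unfolding g_def by metis
  have g0: "g y \<ge> 0" for y by (simp add: g_def)
  have step: "(y - x) * g y \<le> G y - G x" if "0 < x" "x < y" for x y
  proof -
    obtain z where "x < z" "z < y" "G y - G x = (y - x) * g z"
      using MVT2[OF \<open>x < y\<close>, of G g] \<open>0 < x\<close> der by force
    then show ?thesis
      using log_kernel_antimono[of q z y] that q by (simp add: g_def mult_left_mono)
  qed
  have first: "h * g h \<le> G h"
  proof (rule tendsto_le)
    show "((\<lambda>\<epsilon>. (h - \<epsilon>) * g h) \<longlongrightarrow> h * g h) (at_right 0)"
      by (auto intro!: tendsto_eq_intros)
    show "((\<lambda>\<epsilon>. G h - G \<epsilon>) \<longlongrightarrow> G h) (at_right 0)"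
      using tendsto_diff[OF tendsto_const G0] by fastforce
    show "\<forall>\<^sub>F \<epsilon> in at_right 0. (h - \<epsilon>) * g h \<le> G h - G \<epsilon>"
      using h step eventually_at_right_less eventually_at_right_real[OF h]
      by (auto elim!: eventually_mono)
  qed simp
  have mono: "G x \<le> G y" if "0 < x" "x < y" for x y
    using step[OF that] g0[of y] that mult_nonneg_nonneg[of "y - x" "g y"] by linarith
  have le_inf: "G x \<le> pi / sin (pi / q)" if "x > 0" for x
    by (rule tendsto_lowerbound[OF Ginf])
       (use mono that in \<open>auto intro: eventually_mono[OF eventually_gt_at_top[of x]]\<close>)
  have "h * (\<Sum>n=1..<Suc (Suc N). g (real n * h)) \<le> G (real (Suc N) * h)" for N
  proof (induction N)
    case (Suc N)
    have "h * g (real (Suc (Suc N)) * h) \<le> G (real (Suc (Suc N)) * h) - G (real (Suc N) * h)"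
      using step[of "real (Suc N) * h" "real (Suc (Suc N)) * h"] h
      by (simp add: algebra_simps add_pos_nonneg)
    with Suc show ?case
      by (subst sum.atLeastLessThan_Suc) (auto simp: algebra_simps)
  qed (use first in simp)
  from this[of N] have "h * (\<Sum>n=1..<Suc (Suc N). g (real n * h)) \<le> pi / sin (pi / q)"
    using le_inf[of "real (Suc N) * h"] h by simp
  moreover have "(\<Sum>n=1..<N. g (real n * h)) \<le> (\<Sum>n=1..<Suc (Suc N). g (real n * h))"
    by (rule sum_mono2) (auto simp: g0)
  ultimately show ?thesis
    unfolding g_def using h by (meson mult_left_mono less_imp_le order_trans)
qed

text \<open>
  Here the integral over the cell to the right is the smaller one. The sum starts at a fixed $k \ge 1$,
  which loses $G(kh)$, the integral over $[0, kh]$; this tends to $0$ with $h$. Bounding all partial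
  sums by one $X$ lets $N$ tend to infinity for a fixed $h$.
\<close>

lemma sum_log_ge:
  fixes q :: real
  assumes q: "q > 1"
  obtains G :: "real \<Rightarrow> real" where
    "(G \<longlongrightarrow> 0) (at_right 0)"
    "\<And>h k X. h > 0 \<Longrightarrow> k \<ge> 1 \<Longrightarrow>
       (\<And>N. (\<Sum>n=k..<k + N. ln (1 + (real n * h) powr (- q))) \<le> X) \<Longrightarrow>
       pi / sin (pi / q) - G (real k * h) \<le> h * X"
proof -
  define g where "g = (\<lambda>y::real. ln (1 + y powr (- q)))"
  obtain G where der: "\<And>y. y > 0 \<Longrightarrow> (G has_real_derivative g y) (at y)"
    and G0: "(G \<longlongrightarrow> 0) (at_right 0)"
    and Ginf: "(G \<longlongrightarrow> pi / sin (pi / q)) at_top"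
    using log_antiderivative[OF q] unfolding g_def by metis
  have step: "G y - G x \<le> (y - x) * g x" if "0 < x" "x < y" for x y
  proof -
    obtain z where "x < z" "z < y" "G y - G x = (y - x) * g z"
      using MVT2[OF \<open>x < y\<close>, of G g] \<open>0 < x\<close> der by force
    then show ?thesis
      using log_kernel_antimono[of q x z] that q by (simp add: g_def mult_left_mono)
  qed
  show thesis
  proof (rule that[OF G0])
    fix h :: real and k :: nat and X :: real
    assume h: "h > 0" and k: "k \<ge> 1"
      and X: "\<And>N. (\<Sum>n=k..<k + N. ln (1 + (real n * h) powr (- q))) \<le> X"
    have "G (real (k + N) * h) - G (real k * h) \<le> h * (\<Sum>n=k..<k + N. g (real n * h))" for N
    proof (induction N)
      case (Suc N)
      have "G (real (k + Suc N) * h) - G (real (k + N) * h) \<le> h * g (real (k + N) * h)"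
        using step[of "real (k + N) * h" "real (k + Suc N) * h"] h k
        by (simp add: algebra_simps add_nonneg_pos)
      with Suc show ?case by (simp add: algebra_simps)
    qed simp
    also have "h * (\<Sum>n=k..<k + N. g (real n * h)) \<le> h * X" for N
      using X[of N] h by (simp add: g_def)
    finally have le: "G (real (k + N) * h) - G (real k * h) \<le> h * X" for N .
    have "filterlim (\<lambda>N. real (k + N) * h) at_top sequentially"
      using h by real_asymp
    then have "(\<lambda>N. G (real (k + N) * h) - G (real k * h)) \<longlonglongrightarrow> pi / sin (pi / q) - G (real k * h)"
      by (intro tendsto_diff tendsto_const filterlim_compose[OF Ginf])
    then show "pi / sin (pi / q) - G (real k * h) \<le> h * X"
      by (rule tendsto_upperbound) (auto simp: le simp del: of_nat_add)
  qed
qed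

section \<open>Sequences with ratios $1 + a/n + o(1/n)$\<close>

lemma summable_raabe_limit:
  fixes f :: "nat \<Rightarrow> real"
  assumes pos: "\<And>n. f n > 0" and lim: "(\<lambda>n. real n * (f n / f (Suc n) - 1)) \<longlonglongrightarrow> r"
    and r: "r > 1"
  shows "summable f"
proof (rule raabes_test_convergence)
  have "liminf (\<lambda>n. ereal (real n * (f n / f (Suc n) - 1))) = ereal r"
    using lim by (intro lim_imp_Liminf) auto
  then show "1 < liminf (\<lambda>n. ereal (real n * (f n / f (Suc n) - 1)))"
    using r by simp
qed (use pos in simp)

text \<open>
  The quantity $\lim n (f_n - 1)$ is additive like a logarithm because $n (f_n - 1)(g_n - 1)$ tends to
  $0$. So the exponents of the masses and of the gaps can be read off from the linear factors of the
  rates.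
\<close>

lemma raabe_limit_mult:
  fixes f g :: "nat \<Rightarrow> real"
  assumes f: "(\<lambda>n. real n * (f n - 1)) \<longlonglongrightarrow> a" and g: "(\<lambda>n. real n * (g n - 1)) \<longlonglongrightarrow> b"
  shows "(\<lambda>n. real n * (f n * g n - 1)) \<longlonglongrightarrow> a + b"
proof -
  have "(\<lambda>n. real n * (g n - 1) * (1 / real n)) \<longlonglongrightarrow> b * 0"
    by (intro tendsto_mult g) real_asymp
  moreover have "\<forall>\<^sub>F n in sequentially. real n * (g n - 1) * (1 / real n) = g n - 1"
    using eventually_gt_at_top[of 0] by eventually_elim simp
  ultimately have "(\<lambda>n. g n - 1) \<longlonglongrightarrow> 0"
    by (simp add: filterlim_cong[OF refl refl])
  then have "g \<longlonglongrightarrow> 1"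
    by (rule LIM_zero_cancel)
  then have "(\<lambda>n. real n * (f n - 1) * g n + real n * (g n - 1)) \<longlonglongrightarrow> a * 1 + b"
    by (intro tendsto_intros f g)
  moreover have "real n * (f n - 1) * g n + real n * (g n - 1) = real n * (f n * g n - 1)" for n
    by (simp add: algebra_simps)
  ultimately show ?thesis by simp
qed

lemma raabe_limit_prod:
  fixes f :: "'i \<Rightarrow> nat \<Rightarrow> real"
  assumes "finite A" and "\<And>i. i \<in> A \<Longrightarrow> (\<lambda>n. real n * (f i n - 1)) \<longlonglongrightarrow> a i"
  shows "(\<lambda>n. real n * ((\<Prod>i\<in>A. f i n) - 1)) \<longlonglongrightarrow> (\<Sum>i\<in>A. a i)"
  using assms by (induction A rule: finite_induct) (auto intro!: raabe_limit_mult)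

lemma raabe_limit_linear:
  fixes p A B :: real
  assumes "p > 0"
  shows "(\<lambda>n. real n * ((p * real n + A) / (p * real n + B) - 1)) \<longlonglongrightarrow> (A - B) / p"
  using assms by (real_asymp simp: field_simps)

lemma raabe_limit_ratio:
  fixes p :: real
  assumes p: "p > 0" and I: "finite I"
  shows "(\<lambda>n. real n * ((\<Prod>i\<in>I. p * real n + A i) / (\<Prod>i\<in>I. p * real n + B i) - 1))
    \<longlonglongrightarrow> ((\<Sum>i\<in>I. A i) - (\<Sum>i\<in>I. B i)) / p"
  using raabe_limit_prod[OF I raabe_limit_linear[OF p], of A B]
  by (simp add: prod_dividef sum_divide_distrib sum_subtractf diff_divide_distrib)

text \<open>
  The factors on the right telescope to $(N+1)^K$ over $n < N$. By Bernoulli's inequality they dominate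
  any sequence of the form $1 + O(1/n)$.
\<close>

lemma raabe_limit_bound:
  fixes f :: "nat \<Rightarrow> real"
  assumes lim: "(\<lambda>n. real n * (f n - 1)) \<longlonglongrightarrow> a"
  obtains K :: nat where "\<And>n. sqrt (f n) \<le> (1 + 1 / real (Suc n)) ^ K"
proof -
  obtain B where B: "\<And>n. \<bar>real n * (f n - 1)\<bar> \<le> B"
    using convergent_imp_Bseq[OF convergentI[OF lim]] unfolding Bseq_def by auto
  \<comment> \<open>The factor 2 compensates $1/n \le 2/(n+1)$; the value at index 0 is not controlled by the limit.\<close>
  define K where "K = nat \<lceil>max (2 * B) (\<bar>f 0\<bar>)\<rceil>"
  have K: "2 * B \<le> real K" "f 0 \<le> real K" unfolding K_def by linarith+
  show thesis
  proof (rule that[of K])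
    fix n
    have "f n \<le> 1 + real K / real (Suc n)"
    proof (cases "n = 0")
      case False
      have B0: "B \<ge> 0" using B[of 0] by simp
      have "f n - 1 \<le> B / real n"
        using False B[of n] by (simp add: field_simps abs_le_iff)
      also have "\<dots> \<le> (2 * B) / real (Suc n)"
        using False mult_left_mono[OF _ B0, of 1 "real n"] by (simp add: field_simps)
      also have "\<dots> \<le> real K / real (Suc n)"
        using K by (intro divide_right_mono) auto
      finally show ?thesis by simp
    qed (use K in simp)
    also have "\<dots> \<le> (1 + 1 / real (Suc n)) ^ K"
    proof -
      have "- 1 \<le> 1 / real (Suc n)" by (rule order_trans[of _ 0]) auto
      from Bernoulli_inequality[OF this, of K] show ?thesis by simp
    qed
    also have "\<dots> \<le> ((1 + 1 / real (Suc n)) ^ K)\<^sup>2"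
      by (intro self_le_power one_le_power) auto
    finally show "sqrt (f n) \<le> (1 + 1 / real (Suc n)) ^ K"
      by (intro real_le_lsqrt) auto
  qed
qed

text \<open>
  For $\delta < r - 1$ the sequence $f_n (n+1)^\delta$ still passes Raabe's test, and its sum
  bounds every tail of $f$ multiplied by $(N+1)^\delta$.
\<close>

lemma raabe_tail_bound:
  fixes f :: "nat \<Rightarrow> real"
  assumes pos: "\<And>n. f n > 0" and lim: "(\<lambda>n. real n * (f n / f (Suc n) - 1)) \<longlonglongrightarrow> r"
    and r: "r > 1"
  obtains \<delta> C where "\<delta> > 0" "C \<ge> 0" "\<And>N. (\<Sum>k. f (N + k)) \<le> C * real (Suc N) powr (- \<delta>)"
proof -
  define \<delta> where "\<delta> = (r - 1) / 2"
  have \<delta>: "\<delta> > 0" "r - \<delta> > 1" using r by (auto simp: \<delta>_def field_simps)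
  define g where "g = (\<lambda>n. f n * real (Suc n) powr \<delta>)"
  have g0: "g n > 0" for n using pos by (simp add: g_def)
  have sf: "summable f" by (rule summable_raabe_limit[OF pos lim r])
  have "(\<lambda>n. real n * ((real (Suc n) powr \<delta> / real (Suc (Suc n)) powr \<delta>) - 1)) \<longlonglongrightarrow> - \<delta>"
    using \<delta> by real_asymp
  from raabe_limit_mult[OF lim this]
  have "(\<lambda>n. real n * (g n / g (Suc n) - 1)) \<longlonglongrightarrow> r - \<delta>"
    by (simp add: g_def)
  then have sg: "summable g" by (rule summable_raabe_limit[OF g0]) (use \<delta> in simp)
  show thesis
  proof (rule that[OF \<delta>(1), of "suminf g"])
    show "0 \<le> suminf g" using g0 by (intro suminf_nonneg sg) (auto intro: less_imp_le)
    fix N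
    have sfN: "summable (\<lambda>k. f (N + k))" and sgN: "summable (\<lambda>k. g (N + k))"
      using sf sg by (simp_all add: summable_iff_shift add.commute[of N])
    have "real (Suc N) powr \<delta> * (\<Sum>k. f (N + k)) = (\<Sum>k. real (Suc N) powr \<delta> * f (N + k))"
      by (rule suminf_mult[OF sfN, symmetric])
    also have "\<dots> \<le> (\<Sum>k. g (N + k))"
    proof (rule suminf_le[OF _ summable_mult[OF sfN] sgN])
      show "real (Suc N) powr \<delta> * f (N + k) \<le> g (N + k)" for k
        using pos[of "N + k"] \<delta> by (simp add: g_def mult.commute powr_mono2)
    qed
    also have "\<dots> \<le> suminf g"
      using suminf_minus_initial_segment[OF sg, of N] g0
        sum_nonneg[of "{..<N}" g] by (simp add: add.commute less_imp_le)
    finally show "(\<Sum>k. f (N + k)) \<le> suminf g * real (Suc N) powr (- \<delta>)"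
      by (simp add: powr_minus divide_inverse[symmetric] field_simps)
  qed
qed

section \<open>Order and type of functions with comparable maximum modulus\<close>

lemma Limsup_cong_null:
  fixes f g :: "real \<Rightarrow> real"
  assumes "((\<lambda>x. f x - g x) \<longlongrightarrow> 0) at_top"
  shows "Limsup at_top (\<lambda>x. ereal (f x)) = Limsup at_top (\<lambda>x. ereal (g x))"
proof -
  have le: "Limsup at_top (\<lambda>x. ereal (f x)) \<le> Limsup at_top (\<lambda>x. ereal (g x))"
    if lim: "((\<lambda>x. f x - g x) \<longlongrightarrow> 0) at_top" for f g :: "real \<Rightarrow> real"
  proof (rule ereal_le_epsilon2)
    fix e :: real assume "e > 0"
    then have "\<forall>\<^sub>F x in at_top. \<bar>f x - g x\<bar> < e"
      using tendstoD[OF lim] by (simp add: dist_real_def)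
    then have "\<forall>\<^sub>F x in at_top. ereal (f x) \<le> ereal (g x) + ereal e"
      by eventually_elim auto
    then have "Limsup at_top (\<lambda>x. ereal (f x)) \<le> Limsup at_top (\<lambda>x. ereal (g x) + ereal e)"
      by (rule Limsup_mono)
    also have "\<dots> = Limsup at_top (\<lambda>x. ereal (g x)) + ereal e"
      by (rule Limsup_add_ereal_right) auto
    finally show "Limsup at_top (\<lambda>x. ereal (f x)) \<le> Limsup at_top (\<lambda>x. ereal (g x)) + ereal e" .
  qed
  have "((\<lambda>x. g x - f x) \<longlongrightarrow> 0) at_top"
    using tendsto_minus[OF assms] by simp
  then show ?thesis using le assms by (intro antisym) auto
qed

text \<open>
  Since $S$ grows faster than any power, the subtracted term $d x$ is at most half of the main term,
  so $\ln M$ and $\ln S$ differ by $O(\ln x)$.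
\<close>

lemma ln_comparable:
  fixes S M :: "real \<Rightarrow> real"
  assumes \<alpha>: "\<alpha> > 0" and \<rho>: "\<rho> > 0" and c: "c > 0" and C: "C > 0" and d: "d > 0" and L: "L > 0"
    and lower: "\<forall>\<^sub>F x in at_top. \<alpha> * x powr \<rho> \<le> ln (S x)"
    and S: "\<And>x. x \<ge> 1 \<Longrightarrow> S x \<ge> 0"
    and M1: "\<And>x. x \<ge> 1 \<Longrightarrow> c * S x / (x + L) - d * x \<le> M x"
    and M2: "\<And>x. x \<ge> 1 \<Longrightarrow> M x \<le> C * (S x + 1)"
  shows "((\<lambda>x. ln (M x) / x powr \<rho> - ln (S x) / x powr \<rho>) \<longlongrightarrow> 0) at_top"
proof (rule tendsto_sandwich)
  have big: "\<forall>\<^sub>F x in at_top. S x \<ge> 1 \<and> S x \<ge> 2 * d * x * (x + L) / c"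
  proof -
    have "\<forall>\<^sub>F x in at_top. exp (\<alpha> * x powr \<rho>) \<ge> 2 * d * x * (x + L) / c"
      using \<alpha> \<rho> c d L by real_asymp
    moreover have "\<forall>\<^sub>F x in at_top. exp (\<alpha> * x powr \<rho>) \<ge> 1"
      using \<alpha> \<rho> by real_asymp
    ultimately show ?thesis using lower eventually_ge_at_top[of 1]
    proof eventually_elim
      case (elim x)
      have "\<alpha> * x powr \<rho> > 0" using \<alpha> elim by simp
      then have "ln (S x) > 0" using elim by linarith
      then have "S x > 0" using S[of x] elim by (cases "S x = 0") auto
      then have "exp (\<alpha> * x powr \<rho>) \<le> S x"
        using elim by (metis exp_le_cancel_iff exp_ln)
      then show ?case using elim by (intro conjI; linarith)
    qed
  qed
  show "\<forall>\<^sub>F x in at_top. ln (c / (2 * (x + L))) / x powr \<rho> \<le> ln (M x) / x powr \<rho> - ln (S x) / x powr \<rho>"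
    using big eventually_ge_at_top[of 1]
  proof eventually_elim
    case (elim x)
    have xL: "x + L > 0" using elim L by linarith
    define t where "t = c * S x / (2 * (x + L))"
    have "c * S x / (x + L) = 2 * t" "d * x \<le> t"
      using elim xL c by (simp_all add: t_def field_simps)
    then have "2 * t - d * x \<le> M x" "d * x \<le> t"
      using M1[of x] elim by auto
    then have "t \<le> M x" by linarith
    then have "S x * (c / (2 * (x + L))) \<le> M x"
      by (simp add: t_def mult.commute)
    then have "ln (S x * (c / (2 * (x + L)))) \<le> ln (M x)"
      using elim xL c by (intro ln_mono) auto
    also have "ln (S x * (c / (2 * (x + L)))) = ln (S x) + ln (c / (2 * (x + L)))"
      using elim xL c by (intro ln_mult_pos) auto
    finally show ?case by (simp add: diff_divide_distrib[symmetric] divide_right_mono)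
  qed
  show "\<forall>\<^sub>F x in at_top. ln (M x) / x powr \<rho> - ln (S x) / x powr \<rho> \<le> ln (2 * C) / x powr \<rho>"
    using big eventually_ge_at_top[of 1]
  proof eventually_elim
    case (elim x)
    have xL: "x + L > 0" using elim L by linarith
    define t where "t = c * S x / (2 * (x + L))"
    have "c * S x / (x + L) = 2 * t" "d * x \<le> t" "0 < t"
      using elim xL c by (simp_all add: t_def field_simps)
    then have "2 * t - d * x \<le> M x" "d * x \<le> t" "0 < t"
      using M1[of x] elim by auto
    then have "0 < M x" by linarith
    moreover have "M x \<le> S x * (2 * C)"
    proof -
      have "C * (S x + 1) \<le> C * (2 * S x)" using elim C by (intro mult_left_mono) auto
      then show ?thesis using M2[of x] elim by (simp add: mult.commute mult.left_commute)
    qed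
    ultimately have "ln (M x) \<le> ln (S x * (2 * C))"
      by (intro ln_mono) auto
    also have "\<dots> = ln (S x) + ln (2 * C)"
      using elim C by (intro ln_mult_pos) auto
    finally show ?case by (simp add: diff_divide_distrib[symmetric] divide_right_mono)
  qed
  show "((\<lambda>x. ln (c / (2 * (x + L))) / x powr \<rho>) \<longlongrightarrow> 0) at_top"
    using c L \<rho> by real_asymp
  show "((\<lambda>x. ln (2 * C) / x powr \<rho>) \<longlongrightarrow> 0) at_top"
    using \<rho> by real_asymp
qed

lemma growth_order_eq:
  assumes \<alpha>: "\<alpha> > 0" "\<beta> > 0" and \<rho>: "\<rho> > 0"
    and lower: "\<forall>\<^sub>F x in at_top. \<alpha> * x powr \<rho> \<le> ln (max_modulus f x)"
    and upper: "\<forall>\<^sub>F x in at_top. ln (max_modulus f x) \<le> \<beta> * x powr \<rho>"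
  shows "growth_order f = ereal \<rho>"
proof -
  have "((\<lambda>x. ln (ln (max_modulus f x)) / ln x) \<longlongrightarrow> \<rho>) at_top"
  proof (rule tendsto_sandwich)
    show "\<forall>\<^sub>F x in at_top. ln (\<alpha> * x powr \<rho>) / ln x \<le> ln (ln (max_modulus f x)) / ln x"
      using lower eventually_gt_at_top[of 1]
      by eventually_elim (use \<alpha> in \<open>auto intro!: divide_right_mono ln_mono\<close>)
    show "\<forall>\<^sub>F x in at_top. ln (ln (max_modulus f x)) / ln x \<le> ln (\<beta> * x powr \<rho>) / ln x"
      using lower upper eventually_gt_at_top[of 1]
    proof eventually_elim
      case (elim x)
      have "\<alpha> * x powr \<rho> > 0" using \<alpha> elim by simp
      then show ?case using elim by (intro divide_right_mono ln_mono) auto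
    qed
    show "((\<lambda>x. ln (\<alpha> * x powr \<rho>) / ln x) \<longlongrightarrow> \<rho>) at_top"
      using \<alpha> \<rho> by real_asymp
    show "((\<lambda>x. ln (\<beta> * x powr \<rho>) / ln x) \<longlongrightarrow> \<rho>) at_top"
      using \<alpha> \<rho> by real_asymp
  qed
  then show ?thesis
    unfolding growth_order_def by (intro lim_imp_Limsup) auto
qed

text \<open>
  The two bounds on $\ln S$ fix the order; the type is an upper limit, and those do not see a
  difference that tends to $0$.
\<close>

lemma growth_of_comparable:
  fixes S :: "real \<Rightarrow> real"
  assumes \<alpha>: "\<alpha> > 0" and \<rho>: "\<rho> > 0"
    and lower: "\<forall>\<^sub>F x in at_top. \<alpha> * x powr \<rho> \<le> ln (S x)"
    and upper: "\<forall>\<^sub>F x in at_top. ln (S x) \<le> \<beta> * x powr \<rho>"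
    and comp: "((\<lambda>x. ln (max_modulus f x) / x powr \<rho> - ln (S x) / x powr \<rho>) \<longlongrightarrow> 0) at_top"
  shows "growth_order f = ereal \<rho>"
    and "growth_type f = Limsup at_top (\<lambda>x. ereal (ln (S x) / x powr \<rho>))"
proof -
  have near: "\<forall>\<^sub>F x in at_top. \<bar>ln (max_modulus f x) / x powr \<rho> - ln (S x) / x powr \<rho>\<bar> < \<alpha> / 2"
    using tendstoD[OF comp, of "\<alpha> / 2"] \<alpha> by (simp add: dist_real_def)
  have low: "\<forall>\<^sub>F x in at_top. \<alpha> / 2 * x powr \<rho> \<le> ln (max_modulus f x)"
    using near lower eventually_gt_at_top[of 0]
  proof eventually_elim
    case (elim x)
    then have "\<alpha> \<le> ln (S x) / x powr \<rho>" by (simp add: pos_le_divide_eq)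
    with elim(1) have "\<alpha> / 2 \<le> ln (max_modulus f x) / x powr \<rho>" by linarith
    with elim show ?case by (simp add: pos_le_divide_eq)
  qed
  have up: "\<forall>\<^sub>F x in at_top. ln (max_modulus f x) \<le> (\<bar>\<beta>\<bar> + \<alpha>) * x powr \<rho>"
    using near upper eventually_gt_at_top[of 0]
  proof eventually_elim
    case (elim x)
    then have "ln (S x) / x powr \<rho> \<le> \<beta>" by (simp add: pos_divide_le_eq)
    with elim(1) \<alpha> have "ln (max_modulus f x) / x powr \<rho> \<le> \<bar>\<beta>\<bar> + \<alpha>" by linarith
    with elim show ?case by (simp add: pos_divide_le_eq)
  qed
  show order: "growth_order f = ereal \<rho>"
    by (rule growth_order_eq[OF _ _ \<rho> low up]) (use \<alpha> in auto)
  show "growth_type f = Limsup at_top (\<lambda>x. ereal (ln (S x) / x powr \<rho>))"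
    unfolding growth_type_def order using Limsup_cong_null[OF comp] by simp
qed

lemma Limsup_sandwich:
  fixes f lo hi :: "real \<Rightarrow> real"
  assumes lo: "(lo \<longlongrightarrow> a) at_top" "\<forall>\<^sub>F x in at_top. lo x \<le> f x"
    and hi: "(hi \<longlongrightarrow> b) at_top" "\<forall>\<^sub>F x in at_top. f x \<le> hi x"
  obtains \<tau> where "Limsup at_top (\<lambda>x. ereal (f x)) = ereal \<tau>" "a \<le> \<tau>" "\<tau> \<le> b"
proof -
  have "ereal a = Limsup at_top (\<lambda>x. ereal (lo x))"
    using lo(1) by (intro lim_imp_Limsup[symmetric]) auto
  also have "\<dots> \<le> Limsup at_top (\<lambda>x. ereal (f x))"
    using lo(2) by (intro Limsup_mono) (auto elim: eventually_mono)
  finally have 1: "ereal a \<le> Limsup at_top (\<lambda>x. ereal (f x))" .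
  have "Limsup at_top (\<lambda>x. ereal (f x)) \<le> Limsup at_top (\<lambda>x. ereal (hi x))"
    using hi(2) by (intro Limsup_mono) (auto elim: eventually_mono)
  also have "\<dots> = ereal b"
    using hi(1) by (intro lim_imp_Limsup) auto
  finally have 2: "Limsup at_top (\<lambda>x. ereal (f x)) \<le> ereal b" .
  from 1 2 that show thesis
    by (cases "Limsup at_top (\<lambda>x. ereal (f x))") auto
qed

section \<open>Discrete strings and birth and death rates\<close>

text \<open>
  The displacement and the slope of a massless string that carries a point mass $m_n$ at the start of
  the gap $l_n$, for the spectral parameter $-w$. The sign of the parameter makes every coefficient
  nonnegative for $w \ge 0$.
\<close>

fun string_val string_flux ::
  "(nat \<Rightarrow> real) \<Rightarrow> (nat \<Rightarrow> real) \<Rightarrow> 'a::real_normed_field \<Rightarrow> 'a \<Rightarrow> 'a \<Rightarrow> nat \<Rightarrow> 'a"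
where
  "string_val m l w u v 0 = u"
| "string_val m l w u v (Suc n) =
     string_val m l w u v n + of_real (l n) * string_flux m l w u v (Suc n)"
| "string_flux m l w u v 0 = v"
| "string_flux m l w u v (Suc n) =
     string_flux m l w u v n + w * of_real (m n) * string_val m l w u v n"

lemma string_flux_eq_sum:
  "string_flux m l w u v n = v + w * (\<Sum>k<n. of_real (m k) * string_val m l w u v k)"
  by (induction n) (auto simp: algebra_simps)

lemma string_minus:
  "string_val m l w (- u) (- v) n = - string_val m l w u v n \<and>
   string_flux m l w (- u) (- v) n = - string_flux m l w u v n"
  by (induction n) (auto simp: algebra_simps)

lemma string_of_real:
  fixes x u v :: real
  shows "string_val m l (of_real x :: 'a::real_normed_field) (of_real u) (of_real v) n =
      of_real (string_val m l x u v n) \<and>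
    string_flux m l (of_real x :: 'a) (of_real u) (of_real v) n =
      of_real (string_flux m l x u v n)"
  by (induction n) auto

lemma string_val_zero_energy:
  "string_flux m l 0 u v n = v"
  "string_val m l 0 u v n = u + of_real (\<Sum>k<n. l k) * v"
proof -
  show flux: "string_flux m l 0 u v n = v" for n by (induction n) auto
  show "string_val m l 0 u v n = u + of_real (\<Sum>k<n. l k) * v"
    by (induction n) (auto simp: flux algebra_simps simp del: string_flux.simps(2))
qed

locale birth_death =
  fixes lam mu :: "nat \<Rightarrow> real"
  assumes lam_pos: "lam n > 0"
    and mu_Suc_pos: "mu (Suc n) > 0"
    and mu_0: "mu 0 = 0"
begin

text \<open>
  These are the potential coefficients of the birth and death process; the gaps are chosen so that
  \<open>val_recurrence\<close> is the three-term recurrence.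
\<close>

definition mass :: "nat \<Rightarrow> real" where
  "mass n = (\<Prod>k<n. lam k / mu (Suc k))"

definition gap :: "nat \<Rightarrow> real" where
  "gap n = 1 / (lam n * mass n)"

lemma mass_0 [simp]: "mass 0 = 1"
  and mass_Suc: "mass (Suc n) = mass n * lam n / mu (Suc n)"
  by (auto simp: mass_def)

lemma mass_pos [simp]: "mass n > 0"
  unfolding mass_def using lam_pos mu_Suc_pos by (intro prod_pos) auto

lemma gap_pos [simp]: "gap n > 0"
  using lam_pos by (simp add: gap_def)

lemma lam_nonzero [simp]: "lam n \<noteq> 0" and mu_Suc_nonzero [simp]: "mu (Suc n) \<noteq> 0"
  and mass_nonzero [simp]: "mass n \<noteq> 0"
  using lam_pos[of n] mu_Suc_pos[of n] mass_pos[of n] by linarith+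

lemma mass_gap: "mass n * gap n = 1 / lam n"
  by (simp add: gap_def)

lemma gap_Suc: "gap (Suc n) = gap n * mu (Suc n) / lam (Suc n)"
  by (simp add: gap_def mass_Suc)

lemma gap_0: "gap 0 = 1 / lam 0"
  by (simp add: gap_def)

abbreviation val :: "'a::real_normed_field \<Rightarrow> 'a \<Rightarrow> 'a \<Rightarrow> nat \<Rightarrow> 'a" where
  "val \<equiv> string_val mass gap"

abbreviation flux :: "'a::real_normed_field \<Rightarrow> 'a \<Rightarrow> 'a \<Rightarrow> nat \<Rightarrow> 'a" where
  "flux \<equiv> string_flux mass gap"

text \<open>
  The scaling by $\sqrt{m_n}$ turns the square roots $b_n$ of the Jacobi matrix into the rates
  themselves.
\<close>

lemma b_mass: "birth_death_b lam mu n * sqrt (mass (Suc n)) = lam n * sqrt (mass n)"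
  "birth_death_b lam mu n * sqrt (mass n) = mu (Suc n) * sqrt (mass (Suc n))"
proof -
  have "(lam n * mu (Suc n)) * mass (Suc n) = (lam n)\<^sup>2 * mass n"
    by (simp add: mass_Suc power2_eq_square)
  then show "birth_death_b lam mu n * sqrt (mass (Suc n)) = lam n * sqrt (mass n)"
    using lam_pos[of n]
    by (simp add: birth_death_b_def flip: real_sqrt_mult) (simp add: real_sqrt_mult)
  have "(lam n * mu (Suc n)) * mass n = (mu (Suc n))\<^sup>2 * mass (Suc n)"
    by (simp add: mass_Suc power2_eq_square)
  then show "birth_death_b lam mu n * sqrt (mass n) = mu (Suc n) * sqrt (mass (Suc n))"
    using mu_Suc_pos[of n]
    by (simp add: birth_death_b_def flip: real_sqrt_mult) (simp add: real_sqrt_mult)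
qed

lemma val_recurrence:
  fixes w :: "'a::real_normed_field"
  shows "of_real (lam (Suc n)) * val w u v (Suc (Suc n)) =
     (of_real (lam (Suc n) + mu (Suc n)) + w) * val w u v (Suc n) - of_real (mu (Suc n)) * val w u v n"
proof -
  define F where "F = flux w u v (Suc n)"
  define y where "y = val w u v (Suc n)"
  have y: "val w u v n = y - of_real (gap n) * F"
    by (simp add: y_def F_def del: string_flux.simps(2))
  have "val w u v (Suc (Suc n)) = y + of_real (gap (Suc n)) * (F + w * of_real (mass (Suc n)) * y)"
    unfolding y_def F_def string_val.simps(2)[of _ _ _ _ _ "Suc n"]
      string_flux.simps(2)[of _ _ _ _ _ "Suc n"] ..
  then have "of_real (lam (Suc n)) * val w u v (Suc (Suc n)) =
     of_real (lam (Suc n)) * y + of_real (lam (Suc n) * gap (Suc n)) * F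
       + of_real (lam (Suc n) * (mass (Suc n) * gap (Suc n))) * w * y"
    by (simp only: of_real_mult) (simp add: algebra_simps)
  also have "lam (Suc n) * gap (Suc n) = mu (Suc n) * gap n"
    by (simp add: gap_Suc)
  also have "lam (Suc n) * (mass (Suc n) * gap (Suc n)) = 1"
    by (simp add: mass_gap)
  finally show ?thesis unfolding y y_def[symmetric] by (simp add: algebra_simps)
qed

text \<open>
  Since \<open>u\<close> is the value at index $-1$ and \<open>v\<close> the value at index $0$, the roles of the
  two arguments are exchanged: $b_{-1} = 1$ and $\mu_0 = 0$ make \<open>u\<close> the initial slope.
\<close>

lemma three_term_eq_val:
  "three_term (birth_death_a lam mu) (birth_death_b lam mu) u v z (Suc n) =
     (- 1) ^ n * of_real (sqrt (mass n)) * val (- z) v u n"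
proof -
  let ?a = "birth_death_a lam mu" and ?b = "birth_death_b lam mu"
  let ?r = "three_term ?a ?b u v z"
  have b_pos: "?b k > 0" for k
    using lam_pos mu_Suc_pos by (simp add: birth_death_b_def)
  let ?c = "\<lambda>x::real. complex_of_real x"
  have "?r (Suc n) = (- 1) ^ n * ?c (sqrt (mass n)) * val (- z) v u n \<and>
        ?r (Suc (Suc n)) = (- 1) ^ Suc n * ?c (sqrt (mass (Suc n))) * val (- z) v u (Suc n)"
  proof (induction n)
    case 0
    have "?c (?b 0) * ((- 1) ^ Suc 0 * ?c (sqrt (mass (Suc 0))) * val (- z) v u (Suc 0)) =
        - (?c (?b 0 * sqrt (mass (Suc 0))) * val (- z) v u (Suc 0))"
      by (simp only: of_real_mult) simp
    also have "\<dots> = - (?c (lam 0) * v + ?c (lam 0 * gap 0) * (u - z * v))"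
      unfolding b_mass by (simp only: of_real_mult) (simp add: algebra_simps)
    also have "\<dots> = (z - ?c (?a 0)) * v - u"
      by (simp add: gap_0 birth_death_a_def mu_0 algebra_simps)
    finally show ?case
      using b_pos[of 0] by (simp add: field_simps)
  next
    case (Suc n)
    have "?c (?b (Suc n)) * ((- 1) ^ Suc (Suc n) * ?c (sqrt (mass (Suc (Suc n)))) * val (- z) v u (Suc (Suc n))) =
        (- 1) ^ n * ?c (?b (Suc n) * sqrt (mass (Suc (Suc n)))) * val (- z) v u (Suc (Suc n))"
      by (simp only: of_real_mult) simp
    also have "\<dots> = (- 1) ^ n * ?c (sqrt (mass (Suc n))) * (?c (lam (Suc n)) * val (- z) v u (Suc (Suc n)))"
      unfolding b_mass by (simp only: of_real_mult) (simp only: ac_simps)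
    also have "\<dots> = (z - ?c (?a (Suc n))) * ((- 1) ^ Suc n * ?c (sqrt (mass (Suc n))) * val (- z) v u (Suc n))
        - (- 1) ^ n * ?c (mu (Suc n) * sqrt (mass (Suc n))) * val (- z) v u n"
      unfolding val_recurrence
      by (simp only: of_real_mult birth_death_a_def of_real_add) (simp add: algebra_simps del: string_val.simps(2))
    also have "\<dots> = (z - ?c (?a (Suc n))) * ?r (Suc (Suc n)) - ?c (?b n) * ?r (Suc n)"
      unfolding b_mass[symmetric] Suc.IH[THEN conjunct1] Suc.IH[THEN conjunct2] of_real_mult by (simp only: ac_simps)
    finally have *: "?c (?b (Suc n)) * ((- 1) ^ Suc (Suc n) * ?c (sqrt (mass (Suc (Suc n)))) * val (- z) v u (Suc (Suc n)))
      = (z - ?c (?a (Suc n))) * ?r (Suc (Suc n)) - ?c (?b n) * ?r (Suc n)" .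
    have "?r (Suc (Suc (Suc n))) =
        ((z - ?c (?a (Suc n))) * ?r (Suc (Suc n)) - ?c (?b n) * ?r (Suc n)) / ?c (?b (Suc n))"
      by (subst three_term.simps(3)) simp
    also have "\<dots> = (- 1) ^ Suc (Suc n) * ?c (sqrt (mass (Suc (Suc n)))) * val (- z) v u (Suc (Suc n))"
      unfolding *[symmetric] using b_pos[of "Suc n"] 
      by (simp only: nonzero_mult_div_cancel_left of_real_eq_0_iff less_imp_neq[symmetric] not_False_eq_True)
    finally show ?case using Suc.IH by blast
  qed
  then show ?thesis ..
qed

end

section \<open>The four entire functions of an indeterminate problem\<close>

lemma string_nonneg:
  fixes x u v :: real
  assumes "\<And>n. m n \<ge> 0" "\<And>n. l n \<ge> 0" "x \<ge> 0" "u \<ge> 0" "v \<ge> 0"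
  shows "string_val m l x u v n \<ge> 0 \<and> string_flux m l x u v n \<ge> 0"
  using assms by (induction n) auto

lemma norm_string_le:
  fixes w u v :: "'a::real_normed_field"
  assumes m: "\<And>n. m n \<ge> 0" and l: "\<And>n. l n \<ge> 0"
  shows "norm (string_val m l w u v n) \<le> string_val m l (norm w) (norm u) (norm v) n \<and>
    norm (string_flux m l w u v n) \<le> string_flux m l (norm w) (norm u) (norm v) n"
proof (induction n)
  case (Suc n)
  have "norm (w * of_real (m n) * string_val m l w u v n) \<le>
      norm w * m n * string_val m l (norm w) (norm u) (norm v) n"
    using Suc m[of n] by (simp add: norm_mult mult_left_mono)
  then have flux: "norm (string_flux m l w u v (Suc n)) \<le> string_flux m l (norm w) (norm u) (norm v) (Suc n)"
    using Suc by (simp add: norm_triangle_le)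
  then have "norm (of_real (l n) * string_flux m l w u v (Suc n)) \<le>
      l n * string_flux m l (norm w) (norm u) (norm v) (Suc n)"
    using l[of n] by (simp only: norm_mult norm_of_real abs_of_nonneg mult_left_mono)
  with Suc flux show ?case
    by (auto simp del: string_flux.simps simp add: norm_triangle_le)
qed auto

text \<open>
  Finite total mass and finite length of the string: $P_n(0)^2 = m_n$, and $Q_n(0)^2$ is $m_n$ times the
  square of a partial sum of the gaps.
\<close>

locale indeterminate_birth_death = birth_death +
  assumes summable_mass: "summable mass" and summable_gap: "summable gap"
begin

lemma mass_nonneg [simp]: "mass n \<ge> 0" and gap_nonneg [simp]: "gap n \<ge> 0"
  by (simp_all add: less_imp_le)

lemmas val_nonneg = string_nonneg[of mass gap, OF mass_nonneg gap_nonneg, THEN conjunct1]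
lemmas flux_nonneg = string_nonneg[of mass gap, OF mass_nonneg gap_nonneg, THEN conjunct2]

text \<open>
  In the norm $y + f$ the two half steps cost the factors $1 + x m_n$ and $1 + l_n$. For large $x$ this is
  too crude over the whole string, but it is good on a tail of small mass.
\<close>

lemma val_flux_growth:
  fixes x u v :: real
  assumes "x \<ge> 0" "u \<ge> 0" "v \<ge> 0"
  shows "val x u v (N + j) + flux x u v (N + j) \<le>
    (val x u v N + flux x u v N) * exp (x * (\<Sum>k<j. mass (N + k)) + (\<Sum>k<j. gap (N + k)))"
proof (induction j)
  case (Suc j)
  let ?y = "val x u v (N + j)" and ?s = "flux x u v (N + j)" and ?n = "N + j"
  have pos: "?y \<ge> 0" "?s \<ge> 0" using val_nonneg flux_nonneg assms by auto
  have "val x u v (N + Suc j) + flux x u v (N + Suc j) =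
      ?y + (1 + gap ?n) * (?s + x * mass ?n * ?y)"
    by (simp add: algebra_simps)
  also have "\<dots> \<le> (1 + gap ?n) * ((1 + x * mass ?n) * (?y + ?s))"
  proof -
    have "0 \<le> gap ?n * ?y" "0 \<le> x * mass ?n * ?s * (1 + gap ?n)"
      using pos assms by auto
    then show ?thesis by (simp add: algebra_simps)
  qed
  also have "\<dots> \<le> exp (gap ?n) * (exp (x * mass ?n) * (?y + ?s))"
    using pos assms by (intro mult_mono exp_ge_add_one_self mult_nonneg_nonneg) auto
  also have "\<dots> \<le> exp (gap ?n) * (exp (x * mass ?n) * ((val x u v N + flux x u v N) *
      exp (x * (\<Sum>k<j. mass (N + k)) + (\<Sum>k<j. gap (N + k)))))"
    using Suc by (intro mult_left_mono) auto
  also have "\<dots> = (val x u v N + flux x u v N) *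
      exp (x * (\<Sum>k<Suc j. mass (N + k)) + (\<Sum>k<Suc j. gap (N + k)))"
    by (simp add: exp_add algebra_simps)
  finally show ?case .
qed simp

lemma tail_mass_le: "(\<Sum>k<j. mass (N + k)) \<le> (\<Sum>k. mass (N + k))"
  and tail_gap_le: "(\<Sum>k<j. gap (N + k)) \<le> suminf gap"
proof -
  have "summable (\<lambda>k. mass (N + k))" "summable (\<lambda>k. gap (N + k))"
    using summable_mass summable_gap by (simp_all add: summable_iff_shift add.commute[of N])
  then show "(\<Sum>k<j. mass (N + k)) \<le> (\<Sum>k. mass (N + k))"
    by (intro sum_le_suminf) auto
  have "(\<Sum>k<j. gap (N + k)) = (\<Sum>k=N..<N + j. gap k)"
    by (simp add: sum.atLeastLessThan_shift_0[of _ N] lessThan_atLeast0)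
  also have "\<dots> \<le> suminf gap"
    using summable_gap by (intro sum_le_suminf) auto
  finally show "(\<Sum>k<j. gap (N + k)) \<le> suminf gap" .
qed

lemma val_flux_tail:
  fixes x u v :: real
  assumes "x \<ge> 0" "u \<ge> 0" "v \<ge> 0"
  shows "val x u v (N + j) + flux x u v (N + j) \<le>
    (val x u v N + flux x u v N) * exp (x * (\<Sum>k. mass (N + k)) + suminf gap)"
proof (rule order_trans[OF val_flux_growth[OF assms]])
  show "(val x u v N + flux x u v N) * exp (x * (\<Sum>k<j. mass (N + k)) + (\<Sum>k<j. gap (N + k))) \<le>
    (val x u v N + flux x u v N) * exp (x * (\<Sum>k. mass (N + k)) + suminf gap)"
    using val_nonneg[of x u v N] flux_nonneg[of x u v N] assms tail_mass_le tail_gap_le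
    by (intro mult_left_mono) (auto intro!: add_mono mult_left_mono)
qed

lemma val_bounded:
  fixes x u v :: real
  assumes "x \<ge> 0" "u \<ge> 0" "v \<ge> 0"
  obtains B where "\<And>n. val x u v n \<le> B"
proof (rule that)
  show "val x u v n \<le> (u + v) * exp (x * (\<Sum>k. mass k) + suminf gap)" for n
    using val_flux_tail[OF assms, of 0 n] flux_nonneg[OF assms, of n] by simp
qed

lemma summable_mass_bounded:
  fixes q :: "nat \<Rightarrow> 'a::banach"
  assumes "\<And>k. norm (q k) \<le> mass k * B"
  shows "summable q"
  by (rule summable_comparison_test[OF _ summable_mult2[OF summable_mass, of B]])
     (use assms in auto)

lemma summable_weighted_val:
  fixes w u v :: "'a::{real_normed_field,banach}"
  assumes q: "\<And>k. 0 \<le> q k" "\<And>k. q k \<le> L"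
  shows "summable (\<lambda>k. norm (of_real (mass k * q k) * val w u v k))"
proof -
  obtain B where B: "\<And>n. val (norm w) (norm u) (norm v) n \<le> B"
    using val_bounded[of "norm w" "norm u" "norm v"] by auto
  show ?thesis
  proof (rule summable_mass_bounded)
    fix k
    have "norm (val w u v k) \<le> B"
      using norm_string_le[of mass gap w u v k] B[of k] by simp
    moreover have "0 \<le> L" using q[of 0] by linarith
    ultimately show "norm (norm (of_real (mass k * q k) * val w u v k)) \<le> mass k * (L * B)"
      using q[of k] by (auto simp: norm_mult mult.assoc intro!: mult_left_mono mult_mono)
  qed
qed

text \<open>
  For suitable \<open>q\<close>, \<open>u\<close> and \<open>v\<close> this is the modulus at $-x$ of each of
  $A$, $B + 1$, $C - 1$ and $D$.
\<close>

definition amplitude :: "(nat \<Rightarrow> real) \<Rightarrow> real \<Rightarrow> real \<Rightarrow> real \<Rightarrow> real" where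
  "amplitude q u v x = x * (\<Sum>k. mass k * q k * val x u v k)"

lemma summable_weighted_val_real:
  fixes x u v :: real
  assumes q: "\<And>k. 0 \<le> q k" "\<And>k. q k \<le> L"
  shows "summable (\<lambda>k. mass k * q k * val x u v k)"
  using summable_norm_cancel[OF summable_weighted_val[OF q, where w = x and u = u and v = v]] by simp

text \<open>
  The coefficients of the series in $w = -z$ are nonnegative, so on the circle of radius $r$ its modulus is
  largest at $w = r$.
\<close>

lemma max_modulus_near_amplitude:
  fixes u v c \<epsilon> r :: real
  assumes q: "\<And>k. 0 \<le> q k" "\<And>k. q k \<le> L"
    and uv: "u \<ge> 0" "v \<ge> 0" and r: "r \<ge> 0" and \<epsilon>: "\<bar>\<epsilon>\<bar> = 1"
    and f: "\<And>z. f z = of_real c + of_real \<epsilon> * z *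
      (\<Sum>k. of_real (mass k * q k) * val (- z) (of_real u) (of_real v) k)"
  shows "\<bar>max_modulus f r - amplitude q u v r\<bar> \<le> \<bar>c\<bar>"
proof -
  have upper: "norm (f z) \<le> \<bar>c\<bar> + amplitude q u v r" if z: "z \<in> sphere 0 r" for z
  proof -
    let ?t = "\<lambda>k. of_real (mass k * q k) * val (- z) (of_real u) (of_real v) k"
    have nt: "norm (?t k) \<le> mass k * q k * val r u v k" for k
      using norm_string_le[of mass gap "- z" "of_real u" "of_real v" k] z uv q(1)[of k]
      by (simp add: norm_mult mult_left_mono)
    have "norm (\<Sum>k. ?t k) \<le> (\<Sum>k. norm (?t k))"
      by (rule summable_norm[OF summable_weighted_val[OF q]])
    also have "\<dots> \<le> (\<Sum>k. mass k * q k * val r u v k)"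
      by (rule suminf_le[OF nt summable_weighted_val[OF q] summable_weighted_val_real[OF q]])
    finally have "norm (of_real \<epsilon> * z * (\<Sum>k. ?t k)) \<le> amplitude q u v r"
      using z r \<epsilon> unfolding amplitude_def by (simp add: norm_mult mult_left_mono)
    then show ?thesis
      unfolding f by (intro norm_triangle_le) auto
  qed
  have point: "f (- of_real r) = of_real (c - \<epsilon> * amplitude q u v r)"
  proof -
    have "(\<Sum>k. of_real (mass k * q k) * val (complex_of_real r) (of_real u) (of_real v) k) =
        (\<Sum>k. complex_of_real (mass k * q k * val r u v k))"
      by (simp add: string_of_real)
    also have "\<dots> = of_real (\<Sum>k. mass k * q k * val r u v k)"
      by (rule suminf_of_real[OF summable_weighted_val_real[OF q], symmetric])
    finally show ?thesis unfolding f amplitude_def by simp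
  qed
  have mem: "- of_real r \<in> sphere (0::complex) r" using r by simp
  have "norm (f (- of_real r)) \<le> max_modulus f r"
    unfolding max_modulus_def by (rule cSUP_upper[OF mem bdd_aboveI2[OF upper]])
  moreover have "max_modulus f r \<le> \<bar>c\<bar> + amplitude q u v r"
    unfolding max_modulus_def using mem upper by (intro cSUP_least) auto
  moreover have "amplitude q u v r - \<bar>c\<bar> \<le> norm (f (- of_real r))"
  proof -
    have "\<epsilon> = 1 \<or> \<epsilon> = - 1" using \<epsilon> by linarith
    then show ?thesis unfolding point norm_of_real by auto
  qed
  ultimately show ?thesis by linarith
qed

text \<open>
  The place of the $k$-th mass on the string, which is also the factor by which $Q_k(0)$ differs from
  $-P_k(0)$.
\<close>

definition position :: "nat \<Rightarrow> real" where
  "position k = (\<Sum>j<k. gap j)"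

lemma position_bounds: "0 \<le> position k" "position k \<le> suminf gap"
  unfolding position_def using tail_gap_le[of 0 k] by (auto intro: sum_nonneg)

lemma gap_0_le_position: "k \<noteq> 0 \<Longrightarrow> gap 0 \<le> position k"
  unfolding position_def using sum_mono2[of "{..<k}" "{0}" gap] by auto

abbreviation "jacobi_a \<equiv> birth_death_a lam mu"
abbreviation "jacobi_b \<equiv> birth_death_b lam mu"

lemma orthP_eq: "orthP jacobi_a jacobi_b n z = (- 1) ^ n * of_real (sqrt (mass n)) * val (- z) 1 0 n"
  unfolding orthP_def three_term_eq_val ..

lemma orthQ_eq: "orthQ jacobi_a jacobi_b n z = - ((- 1) ^ n * of_real (sqrt (mass n)) * val (- z) 0 1 n)"
  unfolding orthQ_def three_term_eq_val using string_minus[of mass gap "- z" 0 1 n] by simp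

lemma orthP_at_0: "orthP jacobi_a jacobi_b n 0 = (- 1) ^ n * of_real (sqrt (mass n))"
  by (simp add: orthP_eq string_val_zero_energy)

lemma orthQ_at_0: "orthQ jacobi_a jacobi_b n 0 = - ((- 1) ^ n * of_real (sqrt (mass n) * position n))"
  by (simp add: orthQ_eq string_val_zero_energy position_def)

lemma sign_sqrt_square:
  "((- 1) ^ n * of_real (sqrt (mass n))) * ((- 1) ^ n * of_real (sqrt (mass n)) :: complex) = of_real (mass n)"
proof -
  have "(complex_of_real (sqrt (mass n)))\<^sup>2 = of_real (mass n)"
    by (simp only: of_real_power[symmetric]) simp
  then show ?thesis
    by (simp add: power2_eq_square[symmetric] power_mult_distrib flip: power_mult)
qed

text \<open>
  The factors $(-1)^k \sqrt{m_k}$ at $0$ and at $z$ multiply to $m_k$, which removes all alternating signs.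
\<close>

lemma nev_eq:
  "nevA jacobi_a jacobi_b z = of_real 0 + of_real 1 * z *
     (\<Sum>k. of_real (mass k * position k) * val (- z) (of_real 0) (of_real 1) k)"
  "nevB jacobi_a jacobi_b z = of_real (- 1) + of_real (- 1) * z *
     (\<Sum>k. of_real (mass k * position k) * val (- z) (of_real 1) (of_real 0) k)"
  "nevC jacobi_a jacobi_b z = of_real 1 + of_real (- 1) * z *
     (\<Sum>k. of_real (mass k * 1) * val (- z) (of_real 0) (of_real 1) k)"
  "nevD jacobi_a jacobi_b z = of_real 0 + of_real 1 * z *
     (\<Sum>k. of_real (mass k * 1) * val (- z) (of_real 1) (of_real 0) k)"
proof -
  have QQ: "orthQ jacobi_a jacobi_b k 0 * orthQ jacobi_a jacobi_b k z =
      of_real (mass k * position k) * val (- z) 0 1 k" for k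
    unfolding orthQ_at_0 unfolding orthQ_eq of_real_mult sign_sqrt_square[symmetric] by (simp add: ac_simps)
  have QP: "orthQ jacobi_a jacobi_b k 0 * orthP jacobi_a jacobi_b k z =
      - (of_real (mass k * position k) * val (- z) 1 0 k)" for k
    unfolding orthQ_at_0 orthP_eq of_real_mult sign_sqrt_square[symmetric] by (simp add: ac_simps)
  have PQ: "orthP jacobi_a jacobi_b k 0 * orthQ jacobi_a jacobi_b k z =
      - (of_real (mass k * 1) * val (- z) 0 1 k)" for k
    unfolding orthP_at_0 orthQ_eq of_real_mult sign_sqrt_square[symmetric] by (simp add: ac_simps)
  have PP: "orthP jacobi_a jacobi_b k 0 * orthP jacobi_a jacobi_b k z =
      of_real (mass k * 1) * val (- z) 1 0 k" for k
    unfolding orthP_at_0 unfolding orthP_eq of_real_mult sign_sqrt_square[symmetric] by (simp add: ac_simps)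
  have sum: "summable (\<lambda>k. of_real (mass k * position k) * val (- z) 1 0 k)"
    "summable (\<lambda>k. of_real (mass k * 1) * val (- z) 0 1 k)"
    by (rule summable_norm_cancel[OF summable_weighted_val]; use position_bounds in auto)+
  show "nevA jacobi_a jacobi_b z = of_real 0 + of_real 1 * z *
     (\<Sum>k. of_real (mass k * position k) * val (- z) (of_real 0) (of_real 1) k)"
    by (simp add: nevA_def QQ)
  show "nevB jacobi_a jacobi_b z = of_real (- 1) + of_real (- 1) * z *
     (\<Sum>k. of_real (mass k * position k) * val (- z) (of_real 1) (of_real 0) k)"
    unfolding nevB_def QP suminf_minus[OF sum(1)] by simp
  show "nevC jacobi_a jacobi_b z = of_real 1 + of_real (- 1) * z *
     (\<Sum>k. of_real (mass k * 1) * val (- z) (of_real 0) (of_real 1) k)"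
    unfolding nevC_def PQ suminf_minus[OF sum(2)] by simp
  show "nevD jacobi_a jacobi_b z = of_real 0 + of_real 1 * z *
     (\<Sum>k. of_real (mass k * 1) * val (- z) (of_real 1) (of_real 0) k)"
    by (simp add: nevD_def PP)
qed

lemma summable_orth_at_0:
  "summable (\<lambda>n. (norm (orthP jacobi_a jacobi_b n 0))\<^sup>2 + (norm (orthQ jacobi_a jacobi_b n 0))\<^sup>2)"
proof (rule summable_mass_bounded)
  fix n
  have "(position n)\<^sup>2 \<le> (suminf gap)\<^sup>2"
    using position_bounds by (intro power_mono) auto
  then have "mass n * (1 + (position n)\<^sup>2) \<le> mass n * (1 + (suminf gap)\<^sup>2)"
    by (intro mult_left_mono) auto
  then show "norm ((norm (orthP jacobi_a jacobi_b n 0))\<^sup>2 + (norm (orthQ jacobi_a jacobi_b n 0))\<^sup>2)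
      \<le> mass n * (1 + (suminf gap)\<^sup>2)"
    by (simp add: orthP_at_0 orthQ_at_0 norm_mult norm_power power_mult_distrib algebra_simps)
qed

text \<open>
  $\sigma(x) = |D(-x)|$, the function with which all growth is compared.
\<close>

definition D_mod :: "real \<Rightarrow> real" where
  "D_mod = amplitude (\<lambda>_. 1) 1 0"

text \<open>
  The slope collects the terms $x m_k y_k$, so its limits at the end of the string are $-D(-x)$ and
  $C(-x)$ for the two initial conditions. This turns estimates of the recursion into estimates of
  these functions.
\<close>

lemma flux_LIMSEQ:
  "flux x u v \<longlonglongrightarrow> v + amplitude (\<lambda>_. 1) u v (x::real)"
proof -
  have "(\<lambda>n. \<Sum>k<n. mass k * 1 * val x u v k) \<longlonglongrightarrow> (\<Sum>k. mass k * 1 * val x u v k)"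
    by (rule summable_LIMSEQ[OF summable_weighted_val_real[of "\<lambda>_. 1" 1]]) auto
  then have "(\<lambda>n. v + x * (\<Sum>k<n. mass k * 1 * val x u v k)) \<longlonglongrightarrow> v + amplitude (\<lambda>_. 1) u v x"
    unfolding amplitude_def by (intro tendsto_intros)
  moreover have "flux x u v = (\<lambda>n. v + x * (\<Sum>k<n. mass k * 1 * val x u v k))"
    by (rule ext) (simp add: string_flux_eq_sum)
  ultimately show ?thesis by simp
qed

lemma flux_le_D_mod:
  assumes "x \<ge> 0"
  shows "flux x 1 0 n \<le> D_mod x"
proof -
  have "incseq (flux x 1 0)"
    using assms val_nonneg[of x 1 0] by (intro incseq_SucI) simp
  then show ?thesis
    using flux_LIMSEQ[of x 1 0] by (simp add: D_mod_def incseq_le)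
qed

text \<open>
  For $x \ge 1$, after one step the solution started at $(1, 0)$ is above the one started at $(0, 1)$ in both
  components, and positivity of the recursion preserves this. The next lemma is the converse up to the
  factor $x + \lambda_0$, for the same reason.
\<close>

lemma val_01_le_val_10:
  fixes x :: real
  assumes x: "x \<ge> 1"
  shows "val x 0 1 (Suc n) \<le> val x 1 0 (Suc n) \<and> flux x 0 1 (Suc n) \<le> flux x 1 0 (Suc n)"
proof (induction n)
  case 0
  then show ?case using x by (simp add: add_increasing)
next
  case (Suc n)
  have "flux x 0 1 (Suc (Suc n)) \<le> flux x 1 0 (Suc (Suc n))"
    unfolding string_flux.simps(2)[of _ _ _ _ _ "Suc n"]
    using Suc x by (intro add_mono) (auto intro!: mult_left_mono simp del: string_flux.simps string_val.simps)
  then show ?case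
    unfolding string_val.simps(2)[of _ _ _ _ _ "Suc n"]
    using Suc by (auto intro!: add_mono mult_left_mono simp del: string_flux.simps string_val.simps)
qed

lemma val_10_le_val_01:
  fixes x :: real
  assumes x: "x \<ge> 0"
  defines "K \<equiv> x + lam 0"
  shows "val x 1 0 (Suc n) \<le> K * val x 0 1 (Suc n) \<and> flux x 1 0 (Suc n) \<le> K * flux x 0 1 (Suc n)"
proof (induction n)
  case 0
  then show ?case using lam_pos[of 0] by (simp add: K_def gap_0 field_simps)
next
  case (Suc n)
  have "flux x 1 0 (Suc (Suc n)) \<le> K * flux x 0 1 (Suc n) + x * mass (Suc n) * (K * val x 0 1 (Suc n))"
    unfolding string_flux.simps(2)[of _ _ _ _ _ "Suc n"]
    using Suc x by (intro add_mono) (auto intro!: mult_left_mono simp del: string_flux.simps string_val.simps)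
  also have "\<dots> = K * flux x 0 1 (Suc (Suc n))"
    unfolding string_flux.simps(2)[of _ _ _ _ _ "Suc n"] by (simp add: algebra_simps del: string_flux.simps string_val.simps)
  finally have flux: "flux x 1 0 (Suc (Suc n)) \<le> K * flux x 0 1 (Suc (Suc n))" .
  have "val x 1 0 (Suc (Suc n)) \<le> K * val x 0 1 (Suc n) + gap (Suc n) * (K * flux x 0 1 (Suc (Suc n)))"
    unfolding string_val.simps(2)[of _ _ _ _ _ "Suc n"]
    using Suc flux by (auto intro!: add_mono mult_left_mono simp del: string_flux.simps string_val.simps)
  also have "\<dots> = K * val x 0 1 (Suc (Suc n))"
    unfolding string_val.simps(2)[of _ _ _ _ _ "Suc n"] by (simp add: algebra_simps del: string_flux.simps string_val.simps)
  finally show ?case using flux by blast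
qed

lemma amplitude_C_le:
  assumes "x \<ge> 1"
  shows "1 + amplitude (\<lambda>_. 1) 0 1 x \<le> D_mod x"
proof -
  have "\<exists>N. \<forall>n\<ge>N. flux x 0 1 n \<le> flux x 1 0 n"
    using val_01_le_val_10[OF assms] by (metis Suc_le_D One_nat_def)
  from LIMSEQ_le[OF flux_LIMSEQ flux_LIMSEQ this]
  show ?thesis by (simp add: D_mod_def)
qed

lemma D_mod_le_amplitude_C:
  assumes "x \<ge> 0"
  shows "D_mod x \<le> (x + lam 0) * (1 + amplitude (\<lambda>_. 1) 0 1 x)"
proof -
  have "\<exists>N. \<forall>n\<ge>N. flux x 1 0 n \<le> (x + lam 0) * flux x 0 1 n"
    using val_10_le_val_01[OF assms] by (metis Suc_le_D One_nat_def)
  from LIMSEQ_le[OF flux_LIMSEQ tendsto_mult_left[OF flux_LIMSEQ] this]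
  show ?thesis by (simp add: D_mod_def)
qed

text \<open>
  The weight \<open>position\<close> lies between the first gap and the total length, except at $k = 0$, where it
  vanishes; the term $x u$ accounts for that index.
\<close>

lemma amplitude_position:
  assumes "x \<ge> 0" "u \<ge> 0" "v \<ge> 0"
  shows "gap 0 * (amplitude (\<lambda>_. 1) u v x - x * u) \<le> amplitude position u v x"
    and "amplitude position u v x \<le> suminf gap * amplitude (\<lambda>_. 1) u v x"
proof -
  have sum1: "summable (\<lambda>k. mass k * 1 * val x u v k)"
    by (rule summable_weighted_val_real[of _ 1]) auto
  then have sum1': "summable (\<lambda>k. mass (Suc k) * 1 * val x u v (Suc k))"
    by (subst summable_Suc_iff)
  have sump: "summable (\<lambda>k. mass k * position k * val x u v k)"
    by (rule summable_weighted_val_real[OF position_bounds])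
  have "(\<Sum>k. mass k * position k * val x u v k) \<le> (\<Sum>k. suminf gap * (mass k * 1 * val x u v k))"
  proof (rule suminf_le[OF _ sump summable_mult[OF sum1]])
    show "mass k * position k * val x u v k \<le> suminf gap * (mass k * 1 * val x u v k)" for k
      using mult_right_mono[OF position_bounds(2)[of k], of "mass k * val x u v k"]
        val_nonneg[OF assms, of k] by (simp add: algebra_simps)
  qed
  then show "amplitude position u v x \<le> suminf gap * amplitude (\<lambda>_. 1) u v x"
    using assms(1) unfolding amplitude_def suminf_mult[OF sum1]
    by (subst mult.left_commute) (rule mult_left_mono)
  have "gap 0 * ((\<Sum>k. mass k * 1 * val x u v k) - u) =
      (\<Sum>k. gap 0 * (mass (Suc k) * 1 * val x u v (Suc k)))"
    using suminf_split_head[OF sum1]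
    unfolding suminf_mult[OF sum1'] by (simp del: string_val.simps(2))
  also have "\<dots> \<le> (\<Sum>k. mass (Suc k) * position (Suc k) * val x u v (Suc k))"
  proof (rule suminf_le)
    show "gap 0 * (mass (Suc k) * 1 * val x u v (Suc k)) \<le>
        mass (Suc k) * position (Suc k) * val x u v (Suc k)" for k
      using mult_right_mono[OF gap_0_le_position[of "Suc k"], of "mass (Suc k) * val x u v (Suc k)"]
        val_nonneg[OF assms, of "Suc k"] by (simp add: algebra_simps del: string_val.simps)
    show "summable (\<lambda>k. gap 0 * (mass (Suc k) * 1 * val x u v (Suc k)))"
      by (rule summable_mult[OF sum1'])
    show "summable (\<lambda>k. mass (Suc k) * position (Suc k) * val x u v (Suc k))"
      using sump by (subst summable_Suc_iff)
  qed
  also have "\<dots> = (\<Sum>k. mass k * position k * val x u v k)"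
    using suminf_split_head[OF sump] by (simp add: position_def)
  finally have "x * (gap 0 * ((\<Sum>k. mass k * 1 * val x u v k) - u)) \<le>
      x * (\<Sum>k. mass k * position k * val x u v k)"
    using assms(1) by (rule mult_left_mono)
  then show "gap 0 * (amplitude (\<lambda>_. 1) u v x - x * u) \<le> amplitude position u v x"
    unfolding amplitude_def by (simp add: algebra_simps)
qed

lemma D_mod_nonneg: "x \<ge> 0 \<Longrightarrow> D_mod x \<ge> 0"
  using flux_le_D_mod[of x 0] by simp

text \<open>
  $B$ and $A$ differ from $D$ and $C$ by the weight \<open>position\<close>, and $C$ differs from $D$ in the
  initial condition, so the preceding comparisons cover all four functions.
\<close>

lemma max_modulus_comparable:
  assumes "f \<in> {nevA jacobi_a jacobi_b, nevB jacobi_a jacobi_b, nevC jacobi_a jacobi_b, nevD jacobi_a jacobi_b}"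
  obtains c C d where "c > 0" "C > 0" "d > 0"
    "\<And>x. x \<ge> 1 \<Longrightarrow> c * D_mod x / (x + lam 0) - d * x \<le> max_modulus f x"
    "\<And>x. x \<ge> 1 \<Longrightarrow> max_modulus f x \<le> C * (D_mod x + 1)"
proof (rule that[of "min (gap 0) 1" "max (suminf gap) 1" "gap 0 + 2"])
  show "min (gap 0) 1 > 0" "max (suminf gap) 1 > 0" "gap 0 + 2 > 0"
    by (auto simp: add_nonneg_pos)
  fix x :: real assume x: "x \<ge> 1"
  let ?M = "max_modulus f x" and ?S = "D_mod x" and ?c = "min (gap 0) 1"
  define C where "C = max (suminf gap) 1"
  have C: "suminf gap \<le> C" "1 \<le> C" by (auto simp: C_def)
  let ?U = "amplitude (\<lambda>_. 1) 0 1 x"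
  have S0: "?S \<ge> 0" using D_mod_nonneg x by simp
  have l0: "lam 0 > 0" by (rule lam_pos)
  have U: "?S / (x + lam 0) - 1 \<le> ?U" "1 + ?U \<le> ?S"
    using D_mod_le_amplitude_C[of x] amplitude_C_le[OF x] x l0 by (auto simp: field_simps)
  have cs: "?c * (?S / (x + lam 0)) \<le> gap 0 * (?S / (x + lam 0))" "?c * (?S / (x + lam 0)) \<le> ?S / (x + lam 0)"
    using S0 x l0 mult_right_mono[of ?c _ "?S / (x + lam 0)"] mult_right_mono[of ?c 1 "?S / (x + lam 0)"] by auto
  have Sx: "?S / (x + lam 0) \<le> ?S"
    using S0 x l0 mult_left_mono[of 1 "x + lam 0" ?S] by (simp add: divide_le_eq)
  have Cs: "suminf gap * ?S \<le> C * ?S" "?S \<le> C * ?S" "suminf gap * ?U \<le> C * ?S"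
  proof -
    show "suminf gap * ?S \<le> C * ?S" "?S \<le> C * ?S"
      using S0 C mult_right_mono[of 1 C ?S] by (auto intro: mult_right_mono)
    moreover have "suminf gap * ?U \<le> suminf gap * ?S"
      using U suminf_nonneg[OF summable_gap] by (intro mult_left_mono) auto
    ultimately show "suminf gap * ?U \<le> C * ?S" by linarith
  qed
  define dx where "dx = (gap 0 + 2) * x"
  have "gap 0 * 1 \<le> gap 0 * x" using x by (intro mult_left_mono) auto
  then have gx: "gap 0 + 2 \<le> dx" "gap 0 * x + 2 \<le> dx" "2 \<le> dx"
    unfolding dx_def distrib_right using x gap_nonneg[of 0] by linarith+
  have Sg: "gap 0 * (?S / (x + lam 0)) \<le> gap 0 * ?S" "gap 0 * (?S / (x + lam 0) - 1) \<le> gap 0 * ?U"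
    by (intro mult_left_mono Sx U(1) gap_nonneg)+
  have "?c * (?S / (x + lam 0)) - dx \<le> ?M \<and> ?M \<le> C * ?S + C"
    using assms
  proof (elim insertE emptyE)
    assume f: "f = nevA jacobi_a jacobi_b"
    have "\<bar>?M - amplitude position 0 1 x\<bar> \<le> \<bar>0\<bar>"
      by (rule max_modulus_near_amplitude[OF position_bounds])
         (use x in \<open>auto simp: f nev_eq\<close>)
    then show ?thesis
      using amplitude_position[of x 0 1] cs Sg Cs C gx x
      by (simp add: abs_le_iff algebra_simps)
  next
    assume f: "f = nevB jacobi_a jacobi_b"
    have "\<bar>?M - amplitude position 1 0 x\<bar> \<le> \<bar>- 1\<bar>"
      by (rule max_modulus_near_amplitude[OF position_bounds, where \<epsilon> = "- 1"])
         (use x in \<open>auto simp: f nev_eq\<close>)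
    then show ?thesis
      using amplitude_position[of x 1 0] cs Sg Cs C gx x
      by (simp add: abs_le_iff algebra_simps D_mod_def)
  next
    assume f: "f = nevC jacobi_a jacobi_b"
    have "\<bar>?M - ?U\<bar> \<le> \<bar>1\<bar>"
      by (rule max_modulus_near_amplitude[of "\<lambda>_. 1" 1, where \<epsilon> = "- 1"])
         (use x in \<open>auto simp: f nev_eq\<close>)
    then show ?thesis
      using U cs Cs C gx x
      by (simp add: abs_le_iff algebra_simps)
  next
    assume f: "f = nevD jacobi_a jacobi_b"
    have "\<bar>?M - ?S\<bar> \<le> \<bar>0\<bar>"
      unfolding D_mod_def by (rule max_modulus_near_amplitude[of "\<lambda>_. 1" 1])
         (use x in \<open>auto simp: f nev_eq\<close>)
    then show ?thesis
      using U cs Cs C gx Sx x by (simp add: algebra_simps)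
  qed
  then show "?c * ?S / (x + lam 0) - (gap 0 + 2) * x \<le> ?M" "?M \<le> max (suminf gap) 1 * (?S + 1)"
    by (auto simp: dx_def C_def algebra_simps)
qed

end

section \<open>Bounds for the growth of $D$\<close>

context indeterminate_birth_death
begin

text \<open>
  Dropping the slope that is already present leaves $y_{n+1} \ge y_n + l_n x m_n y_n$, and
  $l_n m_n = 1/\lambda_n$.
\<close>

lemma val_ge_prod:
  fixes x :: real
  assumes x: "x \<ge> 0"
  shows "(\<Prod>k<n. 1 + x / lam k) \<le> val x 1 0 n"
proof (induction n)
  case (Suc n)
  have pos: "val x 1 0 n \<ge> 0" "flux x 1 0 n \<ge> 0"
    using val_nonneg flux_nonneg x by auto
  have "(\<Prod>k<Suc n. 1 + x / lam k) \<le> val x 1 0 n * (1 + x / lam n)"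
    using Suc x lam_pos[of n] by (auto intro!: mult_right_mono)
  also have "\<dots> = val x 1 0 n + gap n * (x * mass n * val x 1 0 n)"
    by (simp add: gap_def algebra_simps)
  also have "\<dots> \<le> val x 1 0 (Suc n)"
    using pos by (simp add: distrib_left)
  finally show ?case .
qed simp

lemma val_le_D_mod:
  assumes x: "x \<ge> 0"
  shows "val x 1 0 n \<le> 1 + suminf gap * D_mod x"
proof -
  have "val x 1 0 n \<le> 1 + position n * D_mod x"
  proof (induction n)
    case (Suc n)
    have "gap n * flux x 1 0 (Suc n) \<le> gap n * D_mod x"
      by (intro mult_left_mono flux_le_D_mod x gap_nonneg)
    moreover have "val x 1 0 (Suc n) = val x 1 0 n + gap n * flux x 1 0 (Suc n)"
      by (simp del: string_flux.simps)
    moreover have "position (Suc n) * D_mod x = position n * D_mod x + gap n * D_mod x"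
      by (simp add: position_def distrib_right)
    ultimately show ?case using Suc by linarith
  qed (simp add: position_def)
  also have "\<dots> \<le> 1 + suminf gap * D_mod x"
    using position_bounds D_mod_nonneg[OF x] by (auto intro: mult_right_mono)
  finally show ?thesis .
qed

text \<open>
  The displacement can grow at most by the length of the string times the largest slope $\sigma(x)$, so
  a lower bound for the displacement is one for $\sigma$.
\<close>

lemma sum_ln_le_ln_D_mod:
  assumes x: "x \<ge> 0"
  shows "(\<Sum>k<n. ln (1 + x / lam k)) \<le> ln (1 + suminf gap * D_mod x)"
proof -
  have f: "1 + x / lam k > 0" for k using x lam_pos[of k] by (simp add: add_pos_nonneg)
  have "(\<Sum>k<n. ln (1 + x / lam k)) = ln (\<Prod>k<n. 1 + x / lam k)"
    using f[THEN less_imp_neq, THEN not_sym] by (subst ln_prod) auto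
  also have "\<dots> \<le> ln (1 + suminf gap * D_mod x)"
    using f order_trans[OF val_ge_prod val_le_D_mod, OF x x, of n]
    by (intro ln_mono prod_pos) auto
  finally show ?thesis .
qed

text \<open>
  With weight $c_n$ on the slope, the half step that adds mass costs $1 + c_n x m_n$ and the half
  step along the gap costs $1 + l_n / c_n$. The choice $c_n^2 = l_n / (x m_n)$ makes both equal to
  $1 + \sqrt{x/\lambda_n}$.
\<close>

lemma weighted_growth:
  fixes x :: real
  assumes x: "x > 0"
    and ratio: "\<And>n. sqrt (gap (Suc n) / mass (Suc n)) \<le>
      (1 + 1 / real (Suc n)) ^ K * sqrt (gap n / mass n)"
  shows "val x 1 0 N + sqrt (gap N / (x * mass N)) * flux x 1 0 N \<le>
    real (Suc N) ^ K * (\<Prod>k<N. 1 + sqrt (x / lam k))\<^sup>2"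
proof (induction N)
  case (Suc n)
  define c where "c = (\<lambda>n. sqrt (gap n / (x * mass n)))"
  let ?y = "val x 1 0 n" and ?s = "flux x 1 0 n" and ?e = "sqrt (x / lam n)"
  let ?s' = "?s + x * mass n * ?y" and ?R = "(1 + 1 / real (Suc n)) ^ K"
  have pos: "?y \<ge> 0" "?s \<ge> 0" using val_nonneg flux_nonneg x by auto
  have c_pos: "c n > 0" using x by (simp add: c_def)
  have e: "?e \<ge> 0" using x lam_pos[of n] by simp
  have R: "?R \<ge> 1" by (rule one_le_power) simp
  have lg: "1 / lam n = mass n * gap n" by (simp add: mass_gap)
  have e1: "c n * (x * mass n) = ?e"
  proof -
    have "c n * (x * mass n) = sqrt ((gap n / (x * mass n)) * (x * mass n)\<^sup>2)"
      unfolding c_def real_sqrt_mult using x by simp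
    also have "(gap n / (x * mass n)) * (x * mass n)\<^sup>2 = x * (1 / lam n)"
      unfolding lg using x by (simp add: power2_eq_square)
    finally show ?thesis by simp
  qed
  have e2: "gap n = ?e * c n"
  proof -
    have "?e * c n = sqrt (x * (1 / lam n) * (gap n / (x * mass n)))"
      unfolding c_def by (simp flip: real_sqrt_mult)
    also have "x * (1 / lam n) * (gap n / (x * mass n)) = (gap n)\<^sup>2"
      unfolding lg using x by (simp add: power2_eq_square)
    finally show ?thesis by simp
  qed
  have c_Suc: "c (Suc n) \<le> ?R * c n"
  proof -
    have c_eq: "c k = sqrt (gap k / mass k) / sqrt x" for k
      unfolding c_def by (simp add: real_sqrt_divide real_sqrt_mult)
    show ?thesis
      using divide_right_mono[OF ratio[of n], of "sqrt x"] x by (simp add: c_eq)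
  qed
  have "val x 1 0 (Suc n) + c (Suc n) * flux x 1 0 (Suc n) = ?y + (gap n + c (Suc n)) * ?s'"
    by (simp add: algebra_simps)
  also have "\<dots> \<le> ?R * ?y + (?R * gap n + ?R * c n) * ?s'"
    using pos R x c_Suc mult_right_mono[OF R, of ?y] mult_right_mono[OF R, of "gap n"]
    by (intro add_mono mult_right_mono) auto
  also have "\<dots> = ?R * (?y + (1 + ?e) * (c n * ?s + c n * (x * mass n) * ?y))"
    unfolding e2 by (simp add: algebra_simps)
  also have "\<dots> = ?R * (?y + (1 + ?e) * (c n * ?s + ?e * ?y))"
    unfolding e1 ..
  also have "\<dots> \<le> ?R * ((1 + ?e)\<^sup>2 * (?y + c n * ?s))"
  proof (rule mult_left_mono)
    have "y + (1 + e) * (t + e * y) \<le> (1 + e)\<^sup>2 * (y + t)"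
      if "e \<ge> 0" "y \<ge> 0" "t \<ge> 0" for e y t :: real
    proof -
      have "0 \<le> e * y" "0 \<le> e * t" "0 \<le> e * e * t" using that by auto
      then show ?thesis by (simp add: algebra_simps power2_eq_square)
    qed
    from this[OF e pos(1)]
    show "?y + (1 + ?e) * (c n * ?s + ?e * ?y) \<le> (1 + ?e)\<^sup>2 * (?y + c n * ?s)"
      using pos c_pos by simp
  qed (use R in simp)
  also have "\<dots> \<le> ?R * ((1 + ?e)\<^sup>2 * (real (Suc n) ^ K * (\<Prod>k<n. 1 + sqrt (x / lam k))\<^sup>2))"
    using Suc R by (intro mult_left_mono) (auto simp: c_def)
  also have "\<dots> = (?R * real (Suc n) ^ K) * (\<Prod>k<Suc n. 1 + sqrt (x / lam k))\<^sup>2"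
    by (simp only: prod.lessThan_Suc power_mult_distrib ac_simps)
  also have "?R * real (Suc n) ^ K = real (Suc (Suc n)) ^ K"
  proof -
    have "(1 + 1 / real (Suc n)) * real (Suc n) = real (Suc (Suc n))"
      by (simp add: field_simps)
    then show ?thesis by (simp only: power_mult_distrib[symmetric])
  qed
  finally show ?case by (simp add: c_def)
qed simp

text \<open>
  The weighted norm serves up to the index $N$ and the norm $y + f$ beyond it. The change of norm at
  $N$ costs $1 + 1/c_N$.
\<close>

lemma ln_D_mod_le:
  fixes x :: real
  assumes x: "x > 0"
    and ratio: "\<And>n. sqrt (gap (Suc n) / mass (Suc n)) \<le>
      (1 + 1 / real (Suc n)) ^ K * sqrt (gap n / mass n)"
  shows "ln (D_mod x) \<le> 2 * (\<Sum>k<N. ln (1 + sqrt (x / lam k))) + real K * ln (real (Suc N))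
    + ln (1 + mass N * sqrt (x * lam N)) + x * (\<Sum>k. mass (N + k)) + suminf gap"
proof -
  define c where "c = sqrt (gap N / (x * mass N))"
  define W where "W = real (Suc N) ^ K * (\<Prod>k<N. 1 + sqrt (x / lam k))\<^sup>2"
  define T where "T = x * (\<Sum>k. mass (N + k)) + suminf gap"
  let ?y = "val x 1 0 N" and ?s = "flux x 1 0 N"
  have f: "1 + sqrt (x / lam k) > 0" for k
    using x lam_pos[of k] by (intro add_pos_nonneg) auto
  have c_pos: "c > 0" using x by (simp add: c_def)
  have pos: "?y \<ge> 0" "?s \<ge> 0" using val_nonneg flux_nonneg x by auto
  have inv: "1 / c = mass N * sqrt (x * lam N)"
  proof -
    have "1 / c = sqrt (x * mass N / gap N)"
      unfolding c_def by (simp add: real_sqrt_divide)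
    also have "x * mass N / gap N = (mass N)\<^sup>2 * (x * lam N)"
      by (simp add: gap_def power2_eq_square)
    also have "sqrt \<dots> = mass N * sqrt (x * lam N)"
      by (simp add: real_sqrt_mult)
    finally show ?thesis .
  qed
  have W: "?y + c * ?s \<le> W"
    unfolding c_def W_def by (rule weighted_growth[OF assms])
  have "?y + ?s \<le> (1 + 1 / c) * (?y + c * ?s)"
    using c_pos pos by (simp add: algebra_simps)
  also have "\<dots> \<le> (1 + 1 / c) * W"
    using W c_pos by (intro mult_left_mono) auto
  finally have yW: "?y + ?s \<le> (1 + 1 / c) * W" .
  have "flux x 1 0 (N + j) \<le> (1 + 1 / c) * W * exp T" for j
  proof -
    have "flux x 1 0 (N + j) \<le> (?y + ?s) * exp T"
      using val_flux_tail[of x 1 0 N j] x val_nonneg[of x 1 0 "N + j"] by (simp add: T_def)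
    also have "\<dots> \<le> (1 + 1 / c) * W * exp T"
      using yW by (rule mult_right_mono) simp
    finally show ?thesis .
  qed
  then have "\<exists>M. \<forall>n\<ge>M. flux x 1 0 n \<le> (1 + 1 / c) * W * exp T"
    by (metis le_iff_add)
  moreover have "flux x 1 0 \<longlonglongrightarrow> D_mod x"
    using flux_LIMSEQ[of x 1 0] by (simp add: D_mod_def)
  ultimately have le: "D_mod x \<le> (1 + 1 / c) * W * exp T"
    by (rule LIMSEQ_le_const2[rotated])
  have "x \<le> D_mod x"
    using flux_le_D_mod[of x 1] x by simp
  then have "ln (D_mod x) \<le> ln ((1 + 1 / c) * W * exp T)"
    using le x by (intro ln_mono) auto
  also have "\<dots> = ln (1 + 1 / c) + (real K * ln (real (Suc N)) + 2 * (\<Sum>k<N. ln (1 + sqrt (x / lam k)))) + T"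
  proof -
    have P: "(\<Prod>k<N. 1 + sqrt (x / lam k)) > 0" using f by (intro prod_pos) auto
    have "ln W = ln (real (Suc N) ^ K) + ln ((\<Prod>k<N. 1 + sqrt (x / lam k))\<^sup>2)"
      unfolding W_def by (intro ln_mult_pos zero_less_power P) auto
    also have "\<dots> = real K * ln (real (Suc N)) + 2 * ln (\<Prod>k<N. 1 + sqrt (x / lam k))"
      using P by (simp add: ln_realpow)
    also have "ln (\<Prod>k<N. 1 + sqrt (x / lam k)) = (\<Sum>k<N. ln (1 + sqrt (x / lam k)))"
      using f[THEN less_imp_neq, THEN not_sym] by (subst ln_prod) auto
    finally have "ln W = real K * ln (real (Suc N)) + 2 * (\<Sum>k<N. ln (1 + sqrt (x / lam k)))" .
    moreover have "W > 0" unfolding W_def by (intro mult_pos_pos zero_less_power P) auto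
    ultimately show ?thesis
      using c_pos by (simp add: ln_mult_pos add_pos_pos)
  qed
  finally show ?thesis unfolding inv T_def by simp
qed

end

text \<open>
  For the step $h = q\, x^{-1/q}$ the kernel values $(mh)^{-q}$ and $(mh)^{-q/2}$ are the quantities
  $x/\lambda$ and $\sqrt{x/\lambda}$ for the rate $\lambda = (qm)^q$.
\<close>

lemma scaled_powr:
  fixes q x m :: real
  assumes "q > 0" "x > 0" "m > 0"
  shows "(m * (q * x powr (- (1 / q)))) powr (- q) = x / (q * m) powr q"
    and "(m * (q * x powr (- (1 / q)))) powr (- (q / 2)) = sqrt (x / (q * m) powr q)"
proof -
  define y where "y = q * m"
  have y: "y > 0" using assms by (simp add: y_def)
  have e: "m * (q * x powr (- (1 / q))) = y * x powr (- (1 / q))"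
    by (simp add: y_def)
  have x: "(x powr (- (1 / q))) powr (- q) = x" "(x powr (- (1 / q))) powr (- (q / 2)) = x powr (1 / 2)"
    using assms by (simp_all add: powr_powr)
  show "(m * (q * x powr (- (1 / q)))) powr (- q) = x / (q * m) powr q"
    unfolding e powr_mult x powr_minus_divide[of y] y_def[symmetric] by simp
  have "sqrt (x / (q * m) powr q) = (x / y powr q) powr (1 / 2)"
    using assms y by (simp add: powr_half_sqrt y_def[symmetric])
  also have "\<dots> = x powr (1 / 2) / y powr (q / 2)"
    using assms y by (simp add: powr_divide powr_powr)
  also have "\<dots> = (m * (q * x powr (- (1 / q)))) powr (- (q / 2))"
    unfolding e powr_mult x powr_minus_divide[of y] y_def[symmetric] by simp
  finally show "(m * (q * x powr (- (1 / q)))) powr (- (q / 2)) = sqrt (x / (q * m) powr q)" ..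
qed

context indeterminate_birth_death
begin

lemma D_mod_ge_id: "x \<ge> 0 \<Longrightarrow> x \<le> D_mod x"
  using flux_le_D_mod[of x 1] by simp

lemma ln_D_mod_lower_growth:
  assumes q: "q > 1" and k: "k \<ge> 1"
    and lam_le: "\<And>n. lam n \<le> (q * real (n + k)) powr q"
  obtains lo where "(lo \<longlongrightarrow> pi / (q * sin (pi / q))) at_top"
    "\<forall>\<^sub>F x in at_top. lo x \<le> ln (D_mod x) / x powr (1 / q)"
proof -
  define h where "h = (\<lambda>x. q * x powr (- (1 / q)))"
  define L where "L = suminf gap"
  have L: "L \<ge> 0" unfolding L_def by (rule suminf_nonneg[OF summable_gap]) simp
  obtain G where G0: "(G \<longlongrightarrow> 0) (at_right 0)"
    and G: "\<And>h k X. h > 0 \<Longrightarrow> k \<ge> 1 \<Longrightarrow>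
       (\<And>N. (\<Sum>n=k..<k + N. ln (1 + (real n * h) powr (- q))) \<le> X) \<Longrightarrow>
       pi / sin (pi / q) - G (real k * h) \<le> h * X"
    using sum_log_ge[OF q] by metis
  define lo where
    "lo = (\<lambda>x. (pi / sin (pi / q) - G (real k * h x)) / q - ln (1 + L) / x powr (1 / q))"
  show thesis
  proof (rule that[of lo])
    have "filterlim (\<lambda>x. real k * h x) (at_right 0) at_top"
      unfolding h_def using q k by real_asymp
    then have "((\<lambda>x. G (real k * h x)) \<longlongrightarrow> 0) at_top"
      by (rule filterlim_compose[OF G0])
    moreover have "((\<lambda>x. ln (1 + L) / x powr (1 / q)) \<longlongrightarrow> 0) at_top"
      using q L by real_asymp
    ultimately have "(lo \<longlongrightarrow> (pi / sin (pi / q) - 0) / q - 0) at_top"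
      unfolding lo_def using q by (intro tendsto_intros) auto
    then show "(lo \<longlongrightarrow> pi / (q * sin (pi / q))) at_top"
      by (simp add: mult.commute)
    show "\<forall>\<^sub>F x in at_top. lo x \<le> ln (D_mod x) / x powr (1 / q)"
      using eventually_ge_at_top[of 1]
    proof eventually_elim
      case (elim x)
      have h_pos: "h x > 0" using elim q by (simp add: h_def)
      have "(\<Sum>n=k..<k + N. ln (1 + (real n * h x) powr (- q))) \<le> ln (1 + L * D_mod x)" for N
      proof -
        have "(\<Sum>n=k..<k + N. ln (1 + (real n * h x) powr (- q))) =
            (\<Sum>n<N. ln (1 + (real (n + k) * h x) powr (- q)))"
          using sum.shift_bounds_nat_ivl[of "\<lambda>n. ln (1 + (real n * h x) powr (- q))" 0 k N]
          by (simp add: lessThan_atLeast0 add.commute)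
        also have "\<dots> \<le> (\<Sum>n<N. ln (1 + x / lam n))"
        proof (rule sum_mono)
          fix n
          have "(real (n + k) * h x) powr (- q) = x / (q * real (n + k)) powr q"
            unfolding h_def using q elim k by (intro scaled_powr) auto
          also have "\<dots> \<le> x / lam n"
            using elim lam_le[of n] mult_pos_pos[OF less_le_trans[OF lam_pos lam_le] lam_pos, of n n]
            by (intro divide_left_mono) auto
          finally show "ln (1 + (real (n + k) * h x) powr (- q)) \<le> ln (1 + x / lam n)"
            by (intro ln_mono) (auto simp: add_pos_nonneg)
        qed
        also have "\<dots> \<le> ln (1 + L * D_mod x)"
          unfolding L_def using elim by (intro sum_ln_le_ln_D_mod) simp
        finally show ?thesis .
      qed
      from G[OF h_pos k this]
      have "(pi / sin (pi / q) - G (real k * h x)) / q \<le> h x * ln (1 + L * D_mod x) / q"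
        using q by (intro divide_right_mono) auto
      also have "\<dots> = ln (1 + L * D_mod x) / x powr (1 / q)"
        using q by (simp add: h_def powr_minus_divide)
      also have "\<dots> \<le> (ln (D_mod x) + ln (1 + L)) / x powr (1 / q)"
      proof (rule divide_right_mono)
        have s: "D_mod x \<ge> 1" using D_mod_ge_id[of x] elim by simp
        then have "ln (1 + L * D_mod x) \<le> ln (D_mod x * (1 + L))"
          using L by (intro ln_mono) (auto simp: algebra_simps add_pos_nonneg)
        then show "ln (1 + L * D_mod x) \<le> ln (D_mod x) + ln (1 + L)"
          using s L by (simp add: ln_mult_pos)
      qed simp
      finally show ?case by (simp add: lo_def add_divide_distrib)
    qed
  qed
qed

text \<open>
  The comparison $\lambda_n \ge (qn)^q$ says nothing at $n = 0$, so that term is kept apart. With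
  $N \approx x^{1/\delta}$ the tail contributes at most $C$, and everything except the Riemann sum is
  $O(\ln x)$.
\<close>

lemma ln_D_mod_upper_growth:
  assumes q: "q > 2"
    and lam_ge: "\<And>n. n \<ge> 1 \<Longrightarrow> (q * real n) powr q \<le> lam n"
    and lam_le: "\<And>n. lam n \<le> (q * (real n + B)) powr q" and B: "B > 0"
    and ratio: "\<And>n. sqrt (gap (Suc n) / mass (Suc n)) \<le>
      (1 + 1 / real (Suc n)) ^ K * sqrt (gap n / mass n)"
    and \<delta>: "\<delta> > 0" and C: "C \<ge> 0"
    and tail: "\<And>N. (\<Sum>k. mass (N + k)) \<le> C * real (Suc N) powr (- \<delta>)"
  obtains hi where "(hi \<longlongrightarrow> 2 * pi / (q * sin (2 * pi / q))) at_top"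
    "\<forall>\<^sub>F x in at_top. ln (D_mod x) / x powr (1 / q) \<le> hi x"
proof -
  define h where "h = (\<lambda>x. q * x powr (- (1 / q)))"
  define L where "L = suminf gap"
  define A where "A = suminf mass"
  have A: "A > 0" unfolding A_def by (rule suminf_pos[OF summable_mass]) simp
  have mass_le: "mass n \<le> A" for n
    unfolding A_def using sum_le_suminf[OF summable_mass, of "{n}"] by simp
  have l0: "lam 0 > 0" by (rule lam_pos)
  define R where "R = (\<lambda>x. 2 * ln (1 + sqrt (x / lam 0)) + real K * ln (x powr (1 / \<delta>) + 2)
    + (ln (1 + A) + ln x + q * ln (q * (x powr (1 / \<delta>) + 1 + B))) + C + L)"
  have R0: "((\<lambda>x. R x / x powr (1 / q)) \<longlongrightarrow> 0) at_top"
  proof -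
    have 1: "((\<lambda>x. 2 * ln (1 + sqrt (x / lam 0)) / x powr (1 / q)) \<longlongrightarrow> 0) at_top"
      using q l0 by real_asymp
    have 2: "((\<lambda>x. real K * ln (x powr (1 / \<delta>) + 2) / x powr (1 / q)) \<longlongrightarrow> 0) at_top"
      using q \<delta> by real_asymp
    have 3: "((\<lambda>x. (ln (1 + A) + ln x + q * ln (q * (x powr (1 / \<delta>) + 1 + B))) / x powr (1 / q)) \<longlongrightarrow> 0) at_top"
      using q \<delta> A B by real_asymp
    have 4: "((\<lambda>x. (C + L) / x powr (1 / q)) \<longlongrightarrow> 0) at_top"
      using q by real_asymp
    from tendsto_add[OF tendsto_add[OF tendsto_add[OF 1 2] 3] 4] show ?thesis
      by (simp add: R_def add_divide_distrib[symmetric] add.assoc)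
  qed
  define hi where "hi = (\<lambda>x. 2 * pi / (q * sin (2 * pi / q)) + R x / x powr (1 / q))"
  show thesis
  proof (rule that[of hi])
    show "(hi \<longlongrightarrow> 2 * pi / (q * sin (2 * pi / q))) at_top"
      unfolding hi_def using tendsto_add[OF tendsto_const R0] by simp
    show "\<forall>\<^sub>F x in at_top. ln (D_mod x) / x powr (1 / q) \<le> hi x"
      using eventually_ge_at_top[of 1]
    proof eventually_elim
      case (elim x)
      have h_pos: "h x > 0" using elim q by (simp add: h_def)
      \<comment> \<open>This makes $(N+1)^\delta \ge x$, so that $x$ times the mass beyond $N$ is at most $C$.\<close>
      define N where "N = nat \<lceil>x powr (1 / \<delta>)\<rceil>"
      have N1: "x powr (1 / \<delta>) \<le> real (Suc N)" and N2: "real N \<le> x powr (1 / \<delta>) + 1"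
        unfolding N_def by (auto simp: le_nat_iff of_nat_nat ceiling_le_iff) linarith+
      have "(\<Sum>k<N. ln (1 + sqrt (x / lam k))) \<le>
          ln (1 + sqrt (x / lam 0)) + (\<Sum>k=1..<N. ln (1 + (real k * h x) powr (- (q / 2))))"
      proof -
        have "(\<Sum>k<N. ln (1 + sqrt (x / lam k))) \<le>
            ln (1 + sqrt (x / lam 0)) + (\<Sum>k=1..<N. ln (1 + sqrt (x / lam k)))"
        proof (cases "N = 0")
          case False
          then show ?thesis by (simp add: lessThan_atLeast0 sum.atLeast_Suc_lessThan)
        qed (use elim l0 in simp)
        also have "(\<Sum>k=1..<N. ln (1 + sqrt (x / lam k))) \<le>
            (\<Sum>k=1..<N. ln (1 + (real k * h x) powr (- (q / 2))))"
        proof (rule sum_mono)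
          fix n assume "n \<in> {1..<N}"
          then have n: "n \<ge> 1" by simp
          have "sqrt (x / lam n) \<le> sqrt (x / (q * real n) powr q)"
            using elim lam_ge[OF n] lam_pos[of n] n q
            by (intro real_sqrt_le_mono divide_left_mono) auto
          also have "\<dots> = (real n * h x) powr (- (q / 2))"
            unfolding h_def using q elim n by (intro scaled_powr(2)[symmetric]) auto
          finally show "ln (1 + sqrt (x / lam n)) \<le> ln (1 + (real n * h x) powr (- (q / 2)))"
            using elim lam_pos[of n] by (intro ln_mono) (auto intro!: add_pos_nonneg)
        qed
        finally show ?thesis by simp
      qed
      also have "\<dots> \<le> ln (1 + sqrt (x / lam 0)) + pi / sin (2 * pi / q) / h x"
        using sum_log_le[of "q / 2" "h x" N] q h_pos
        unfolding add_le_cancel_left pos_le_divide_eq[OF h_pos] by (simp add: mult.commute)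
      finally have sum: "(\<Sum>k<N. ln (1 + sqrt (x / lam k))) \<le>
        ln (1 + sqrt (x / lam 0)) + pi / sin (2 * pi / q) / h x" .
      have t1: "real K * ln (real (Suc N)) \<le> real K * ln (x powr (1 / \<delta>) + 2)"
        using N2 by (intro mult_left_mono ln_mono) auto
      define Z where "Z = q * (x powr (1 / \<delta>) + 1 + B)"
      have Z: "Z \<ge> 1"
        unfolding Z_def using q B mult_mono[of 1 q 1 "x powr (1 / \<delta>) + 1 + B"] by simp
      then have xZ: "x * Z powr q \<ge> 1"
        using elim q mult_mono[of 1 x 1 "Z powr q"] by (simp add: ge_one_powr_ge_zero)
      have t2: "ln (1 + mass N * sqrt (x * lam N)) \<le> ln (1 + A) + ln x + q * ln Z"
      proof -
        have "lam N \<le> Z powr q"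
          unfolding Z_def using N2 q B by (intro order_trans[OF lam_le] powr_mono2 mult_left_mono) auto
        then have "sqrt (x * lam N) \<le> sqrt (x * Z powr q)"
          using elim by (intro real_sqrt_le_mono mult_left_mono) auto
        also have "\<dots> \<le> x * Z powr q"
          using xZ by (intro real_le_lsqrt self_le_power) auto
        finally have "mass N * sqrt (x * lam N) \<le> A * (x * Z powr q)"
          using mass_le[of N] A elim lam_pos[of N] by (intro mult_mono) auto
        then have "1 + mass N * sqrt (x * lam N) \<le> (1 + A) * (x * Z powr q)"
          using xZ by (simp add: distrib_right)
        then have "ln (1 + mass N * sqrt (x * lam N)) \<le> ln ((1 + A) * (x * Z powr q))"
          using elim lam_pos[of N] by (intro ln_mono) (auto intro!: add_pos_nonneg mult_nonneg_nonneg)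
        also have "\<dots> = ln (1 + A) + ln x + q * ln Z"
          using A elim Z by (simp add: ln_mult_pos ln_powr)
        finally show ?thesis .
      qed
      have t3: "x * (\<Sum>k. mass (N + k)) \<le> C"
      proof -
        have "x = (x powr (1 / \<delta>)) powr \<delta>"
          using elim \<delta> by (simp add: powr_powr)
        also have "\<dots> \<le> real (Suc N) powr \<delta>"
          using N1 \<delta> by (intro powr_mono2) auto
        finally have "x * real (Suc N) powr (- \<delta>) \<le> real (Suc N) powr \<delta> * real (Suc N) powr (- \<delta>)"
          by (rule mult_right_mono) simp
        also have "\<dots> = 1" by (simp flip: powr_add)
        finally have "C * (x * real (Suc N) powr (- \<delta>)) \<le> C * 1"
          using C by (rule mult_left_mono)
        moreover have "x * (\<Sum>k. mass (N + k)) \<le> x * (C * real (Suc N) powr (- \<delta>))"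
          using tail elim by (intro mult_left_mono) auto
        ultimately show ?thesis by (simp add: algebra_simps)
      qed
      have "ln (D_mod x) \<le> 2 * (pi / sin (2 * pi / q) / h x) + R x"
        using ln_D_mod_le[OF _ ratio, of x N] elim sum t1 t2 t3
        unfolding R_def L_def Z_def by simp
      then have "ln (D_mod x) / x powr (1 / q) \<le> (2 * (pi / sin (2 * pi / q) / h x) + R x) / x powr (1 / q)"
        by (rule divide_right_mono) simp
      also have "\<dots> = hi x"
        using elim by (simp add: hi_def h_def add_divide_distrib powr_minus_divide)
      finally show ?case .
    qed
  qed
qed

lemma has_type_between:
  assumes \<rho>: "\<rho> > 0" and a: "a > 0"
    and lo: "(lo \<longlongrightarrow> a) at_top" "\<forall>\<^sub>F x in at_top. lo x \<le> ln (D_mod x) / x powr \<rho>"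
    and hi: "(hi \<longlongrightarrow> b) at_top" "\<forall>\<^sub>F x in at_top. ln (D_mod x) / x powr \<rho> \<le> hi x"
  shows "\<exists>\<tau>. moment_problem_has_type jacobi_a jacobi_b \<tau> \<and> a \<le> \<tau> \<and> \<tau> \<le> b"
proof -
  obtain \<tau> where \<tau>: "Limsup at_top (\<lambda>x. ereal (ln (D_mod x) / x powr \<rho>)) = ereal \<tau>" "a \<le> \<tau>" "\<tau> \<le> b"
    using Limsup_sandwich[OF lo hi] by blast
  have half: "a / 2 < a" and more: "b < b + 1" using a by auto
  have lower: "\<forall>\<^sub>F x in at_top. a / 2 * x powr \<rho> \<le> ln (D_mod x)"
    using order_tendstoD(1)[OF lo(1) half] lo(2) eventually_gt_at_top[of 0]
  proof eventually_elim
    case (elim x)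
    then have "a / 2 \<le> ln (D_mod x) / x powr \<rho>" using a by linarith
    with elim show ?case by (simp add: pos_le_divide_eq)
  qed
  have upper: "\<forall>\<^sub>F x in at_top. ln (D_mod x) \<le> (b + 1) * x powr \<rho>"
    using order_tendstoD(2)[OF hi(1) more] hi(2) eventually_gt_at_top[of 0]
  proof eventually_elim
    case (elim x)
    then have "ln (D_mod x) / x powr \<rho> \<le> b + 1" by linarith
    with elim show ?case by (simp add: pos_divide_le_eq)
  qed
  have "growth_order f = ereal \<rho> \<and> growth_type f = ereal \<tau>"
    if f: "f \<in> {nevA jacobi_a jacobi_b, nevB jacobi_a jacobi_b, nevC jacobi_a jacobi_b, nevD jacobi_a jacobi_b}" for f
  proof -
    obtain c C d where cCd: "c > 0" "C > 0" "d > 0"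
      and comp: "\<And>x. x \<ge> 1 \<Longrightarrow> c * D_mod x / (x + lam 0) - d * x \<le> max_modulus f x"
      "\<And>x. x \<ge> 1 \<Longrightarrow> max_modulus f x \<le> C * (D_mod x + 1)"
      using max_modulus_comparable[OF f] by metis
    have "((\<lambda>x. ln (max_modulus f x) / x powr \<rho> - ln (D_mod x) / x powr \<rho>) \<longlongrightarrow> 0) at_top"
      using a D_mod_nonneg by (intro ln_comparable[OF _ \<rho> cCd lam_pos lower _ comp]) auto
    from growth_of_comparable[OF _ \<rho> lower upper this] a \<tau>(1) show ?thesis by simp
  qed
  then have "moment_problem_has_type jacobi_a jacobi_b \<tau>"
    unfolding moment_problem_has_type_def using summable_orth_at_0 \<rho>
    by (intro conjI exI[of _ "ereal \<rho>"]) auto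
  with \<tau> show ?thesis by blast
qed

end

section \<open>The type for polynomial rates\<close>

theorem theorem1p7:
  fixes p :: nat and e d lam mu :: "nat \<Rightarrow> real" and E D :: real
  assumes "p \<ge> 1"
    and "0 < e 1" and "mono_on {1..p} e"
    and "- real p < d 1" and "mono_on {1..p} d"
    and "(\<Prod>i=1..p. d i) = 0"
    and "E = (\<Sum>i=1..p. e i)" and "D = (\<Sum>i=1..p. d i)"
    and "1 < (E - D) / real p" and "(E - D) / real p < real p - 1"
    and "\<And>n. lam n = (\<Prod>i=1..p. real p * real n + e i)"
    and "\<And>n. mu n = (\<Prod>i=1..p. real p * real n + d i)"
  shows "\<exists>\<tau>. moment_problem_has_type (birth_death_a lam mu) (birth_death_b lam mu) \<tau> \<and>
           pi / (real p * sin (pi / real p)) \<le> \<tau> \<and>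
           \<tau> \<le> pi / (real p * sin (pi / real p) * cos (pi / real p))"
proof -
  let ?s = "(E - D) / real p"
  have p2: "real p > 2" using assms(9,10) by linarith
  have p0: "real p > 0" using p2 by linarith
  have e_pos: "0 < e i" and e_le: "e i \<le> e p" and d_gt: "- real p < d i" if "i \<in> {1..p}" for i
    using that assms(1,2,4) mono_onD[OF assms(3), of 1 i] mono_onD[OF assms(3), of i p]
      mono_onD[OF assms(5), of 1 i] by auto
  interpret birth_death lam mu
  proof
    show "lam n > 0" for n
      unfolding assms(11) using e_pos by (intro prod_pos) (auto intro!: add_nonneg_pos)
    show "mu (Suc n) > 0" for n
      unfolding assms(12)
    proof (intro prod_pos ballI)
      fix i assume i: "i \<in> {1..p}"
      have "real p * real (Suc n) = real p * real n + real p" "0 \<le> real p * real n"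
        by (simp_all add: algebra_simps)
      then show "0 < real p * real (Suc n) + d i" using d_gt[OF i] by linarith
    qed
    show "mu 0 = 0" unfolding assms(12) using assms(6) by simp
  qed
  have lamS: "lam (Suc n) = (\<Prod>i=1..p. real p * real n + (real p + e i))"
    and muS: "mu (Suc n) = (\<Prod>i=1..p. real p * real n + (real p + d i))" for n
    unfolding assms(11,12) by (simp_all add: algebra_simps)
  \<comment> \<open>Consecutive masses and gaps have rational ratios whose factors are linear in $n$.
     Their Raabe limits are $p - s$ and $s$ for $s = (E - D)/p$, and $1 < s < p - 1$ makes both exceed 1.\<close>
  have "(\<lambda>n. real n * (mu (Suc n) / lam n - 1)) \<longlonglongrightarrow>
      ((\<Sum>i=1..p. real p + d i) - (\<Sum>i=1..p. e i)) / real p"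
    unfolding muS assms(11) by (rule raabe_limit_ratio[OF p0]) simp
  then have mu_lam: "(\<lambda>n. real n * (mu (Suc n) / lam n - 1)) \<longlonglongrightarrow> real p - ?s"
    using p0 by (simp add: sum.distrib assms(7,8) field_simps)
  have "(\<lambda>n. real n * (lam (Suc n) / mu (Suc n) - 1)) \<longlonglongrightarrow>
      ((\<Sum>i=1..p. real p + e i) - (\<Sum>i=1..p. real p + d i)) / real p"
    unfolding muS lamS by (rule raabe_limit_ratio[OF p0]) simp
  then have lam_mu: "(\<lambda>n. real n * (lam (Suc n) / mu (Suc n) - 1)) \<longlonglongrightarrow> ?s"
    by (simp add: sum.distrib assms(7,8))
  \<comment> \<open>The product to be bounded is $(c_{n+1}/c_n)^2$ for the weights $c_n$ of the upper bound.\<close>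
  have "(\<lambda>n. real n * (mu (Suc n) / lam (Suc n) - 1)) \<longlonglongrightarrow>
      ((\<Sum>i=1..p. real p + d i) - (\<Sum>i=1..p. real p + e i)) / real p"
    unfolding muS lamS by (rule raabe_limit_ratio[OF p0]) simp
  from raabe_limit_mult[OF this mu_lam] obtain K :: nat
    where K: "\<And>n. sqrt (mu (Suc n) / lam (Suc n) * (mu (Suc n) / lam n)) \<le> (1 + 1 / real (Suc n)) ^ K"
    by (rule raabe_limit_bound) blast
  have mass_lim: "(\<lambda>n. real n * (mass n / mass (Suc n) - 1)) \<longlonglongrightarrow> real p - ?s"
    using mu_lam by (simp add: mass_Suc)
  have gap_lim: "(\<lambda>n. real n * (gap n / gap (Suc n) - 1)) \<longlonglongrightarrow> ?s"
    using lam_mu gap_pos[THEN less_imp_neq, THEN not_sym] by (simp add: gap_Suc)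
  interpret indeterminate_birth_death lam mu
  proof
    show "summable mass" by (rule summable_raabe_limit[OF mass_pos mass_lim]) (use assms(10) in simp)
    show "summable gap" by (rule summable_raabe_limit[OF gap_pos gap_lim assms(9)])
  qed
  have ratio: "sqrt (gap (Suc n) / mass (Suc n)) \<le> (1 + 1 / real (Suc n)) ^ K * sqrt (gap n / mass n)" for n
  proof -
    have eq: "gap (Suc n) / mass (Suc n) = (mu (Suc n) / lam (Suc n) * (mu (Suc n) / lam n)) * (gap n / mass n)"
      by (simp add: gap_Suc mass_Suc field_simps)
    show ?thesis
      unfolding eq real_sqrt_mult[of _ "gap n / mass n"] by (rule mult_right_mono[OF K]) simp
  qed
  obtain \<delta> C where \<delta>: "\<delta> > 0" "C \<ge> 0" "\<And>N. (\<Sum>k. mass (N + k)) \<le> C * real (Suc N) powr (- \<delta>)"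
    using raabe_tail_bound[OF mass_pos mass_lim] assms(10) by (metis less_diff_eq add.commute)
  define k where "k = Suc (nat \<lceil>e p\<rceil>)"
  have k: "k \<ge> 1" "e p \<le> real p * real k"
  proof -
    have "e p \<le> 1 * real k" unfolding k_def using real_nat_ceiling_ge[of "e p"] by simp
    also have "\<dots> \<le> real p * real k" using p2 by (intro mult_right_mono) auto
    finally show "e p \<le> real p * real k" .
  qed (simp add: k_def)
  have lam_le: "lam n \<le> (real p * real (n + k)) powr real p" for n
  proof -
    have "lam n \<le> (\<Prod>i=1..p. real p * real (n + k))"
      unfolding assms(11)
    proof (intro prod_mono conjI)
      fix i assume i: "i \<in> {1..p}"
      show "0 \<le> real p * real n + e i" using e_pos[OF i] by (simp add: add_nonneg_nonneg)
      show "real p * real n + e i \<le> real p * real (n + k)"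
        using e_le[OF i] k(2) by (simp add: distrib_left)
    qed
    then show ?thesis using p0 k(1) by (simp add: powr_realpow)
  qed
  have lam_ge: "(real p * real n) powr real p \<le> lam n" if "n \<ge> 1" for n
  proof -
    have "(\<Prod>i=1..p. real p * real n) \<le> lam n"
      unfolding assms(11) using e_pos by (intro prod_mono) (auto intro: less_imp_le)
    then show ?thesis using p0 that by (simp add: powr_realpow)
  qed
  have p1: "real p > 1" using p2 by linarith
  obtain lo where lo: "(lo \<longlongrightarrow> pi / (real p * sin (pi / real p))) at_top"
    "\<forall>\<^sub>F x in at_top. lo x \<le> ln (D_mod x) / x powr (1 / real p)"
    using ln_D_mod_lower_growth[OF p1 k(1) lam_le] by blast
  have lam_le': "lam n \<le> (real p * (real n + real k)) powr real p" for n
    using lam_le[of n] by simp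
  obtain hi where hi: "(hi \<longlongrightarrow> 2 * pi / (real p * sin (2 * pi / real p))) at_top"
    "\<forall>\<^sub>F x in at_top. ln (D_mod x) / x powr (1 / real p) \<le> hi x"
    using ln_D_mod_upper_growth[OF p2 lam_ge lam_le' _ ratio \<delta>] k(1) by force
  have "pi / real p < pi" using p1 by (simp add: divide_less_eq)
  then have "sin (pi / real p) > 0" using p0 by (intro sin_gt_zero) auto
  then have "pi / (real p * sin (pi / real p)) > 0" using p0 by simp
  from has_type_between[OF _ this lo hi] p0
  have "\<exists>\<tau>. moment_problem_has_type jacobi_a jacobi_b \<tau> \<and>
      pi / (real p * sin (pi / real p)) \<le> \<tau> \<and> \<tau> \<le> 2 * pi / (real p * sin (2 * pi / real p))"
    by simp
  moreover have "2 * pi / (real p * sin (2 * pi / real p)) =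
      pi / (real p * sin (pi / real p) * cos (pi / real p))"
    using sin_double[of "pi / real p"] by (simp add: mult.assoc)
  ultimately show ?thesis by simp
qed

end
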